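(* Let $A\in\mathbb{Z}^{r\times n}$, $\mathbf{b}\in\mathbb{Z}^r$, $M=\begin{pmatrix}\mathrm{id}_n&\mathbf{0}\\ A&-\mathbf{b}\end{pmatrix}$, and let $M_k\langle I;J\rangle$ be a (well-defined) matrix obtained from $M$ by $k$ successive pivot operations with row index set $I\subseteq[r]$ and column index set $J\subseteq[n]$, $|I|=|J|=k$. If $i\in[r]\setminus I$, $j\in[n]\setminus J$ and the $(n+i,j)$ entry of $M_k\langle I;J\rangle$ is nonzero, then $$\mathop{\mathrm{CT}}_{\lambda_i,j}\mathcal{Z}_{\mathbf{y}}[M_k\langle I;J\rangle]=\mathcal{Z}_{\mathbf{y}}\mathop{\mathrm{CT}}_{\lambda_i,j}[M_k\langle I;J\rangle].$$
   Context: Variables: $\mathbf{y}=(y_1,\dots,y_n)$, $\Lambda=(\lambda_1,\dots,\lambda_r)$. "Fractional" means that rational exponents are allowed. $[n]=\{1,\dots,n\}$. Matrix forms. For an $(n+r)\times(n+1)$ matrix $O$ with nonzero $(n+i,j)$ entry ($i\in[r]$, $j\in[n]$), $O\leftarrow(i,j)$ is obtained from $O$ by adding $-O_{n+i,s}/O_{n+i,j}$ times column $j$ to column $s$ for all $s\ne j$; row $n+i$ and column $j$ are ignored afterwards. For $I=\{i_1,\dots,i_k\}$, $J=\{j_1,\dots,j_k\}$, $M_k\langle I;J\rangle=M\leftarrow(i_1,j_1)\leftarrow\cdots\leftarrow(i_k,j_k)$ (assuming all pivots are nonzero), with rows $n+I$ and columns $J$ ignored. With columns $\gamma_1,\dots,\gamma_{n+1}$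 of $M_k\langle I;J\rangle$ set $[M_k\langle I;J\rangle]=(\mathbf{y},\Lambda)^{\gamma_{n+1}}\big/\prod_{j\in[n]\setminus J}\big(1-(\mathbf{y},\Lambda)^{\gamma_j}\big)$, entries in ignored rows being omitted. The factor indexed by $j$ is called the $j$th denominator factor. $\mathcal{Z}_{y_j}$ acts on fractional series by keeping exactly the terms in which the exponent of $y_j$ is an integer, and $\mathcal{Z}_{\mathbf{y}}=\mathcal{Z}_{y_1}\cdots\mathcal{Z}_{y_n}$. On a fractional rational function $L/\prod_j(1-x_j)$ ($L$ a fractional Laurent polynomial, $x_j$ fractional monomials), choosing positive integers $p_j$ such that $x_j^{p_j}$ has integer exponents in $\mathbf{y}$, one has $\mathcal{Z}_{\mathbf{y}}\frac{L}{\prod_j(1-x_j)}=\frac{\mathcal{Z}_{\mathbf{y}}\left(L\prod_j\sum_{t=0}^{p_j-1}x_j^t\right)}{\prod_j(1-x_j^{p_j})}$, and $1-x_j^{p_j}$ is regarded as the $j$th denominator factor of the result. The operator $\mathrm{CT}_{\lambda,j}$. Let $F$ be a fractional rational function with pairwise coprime denominator factors indexed by $j$, the $j$th being $1-(u_j\lambda^{b_j})^{p_j}$ with $u_j$ free of $\lambda$, $b_j\in\mathbb{Q}$, and $p_j$ a positive integer. If $b_j\ne0$, replace $\lambda$ by $\lambda^m$ with $m$ a positive integer making all $\lambda$-exponents integral; rewrite each factor with $b_\ell<0$ by $1-x=-x(1-x^{-1})$ so that all factors have the form $1-v_\ell\lambda^{a_\ell}$ with $a_\ell\ge0$; take the partial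 fraction decomposition in $\lambda$, $F=P(\lambda)+p(\lambda)\lambda^{-t}+\sum_{\ell:\,a_\ell>0}\frac{A_\ell(\lambda)}{1-v_\ell\lambda^{a_\ell}}$ with $P,p,A_\ell$ polynomials in $\lambda$, $\deg p<t$, $\deg A_\ell<a_\ell$; then $\mathrm{CT}_{\lambda,j}F:=A_j(0)$, which does not depend on $m$. When the variable $y_j$ occurs only in $u_j=y_ju_j'$ and $p_j=1$ (as is the case for $F=[M_k\langle I;J\rangle]$, $\lambda=\lambda_i$), this equals $\mathrm{sgn}(b_j)\,\mathcal{Z}_{y_j}\big(F\cdot(1-u_j\lambda^{b_j})\big)\big|_{\lambda=u_j^{-1/b_j}}$. *)

theory Defs
  imports
    Jordan_Normal_Form.Matrix
    "HOL-Library.Poly_Mapping"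
    "HOL-Computational_Algebra.Polynomial"
    "HOL-Computational_Algebra.Fraction_Field"
begin

section \<open>Fractional Laurent polynomials and fractional rational functions\<close>

text \<open>
  Indices are 0-based. The variables are numbered like the rows of the matrices:
  \<open>y\<^sub>j\<close> is variable \<open>j\<close> for \<open>j < n\<close>, and \<open>\<lambda>\<^sub>i\<close> is variable \<open>n + i\<close> for \<open>i < r\<close>.
  A fractional monomial is given by its rational exponent vector.
\<close>

type_synonym exponent = "nat \<Rightarrow>\<^sub>0 rat"

type_synonym 'k flaurent = "exponent \<Rightarrow>\<^sub>0 'k"

definition xpow :: "exponent \<Rightarrow> 'k::field flaurent" where
  "xpow e = Poly_Mapping.single e 1"

definition scale :: "rat \<Rightarrow> exponent \<Rightarrow> exponent" where
  "scale c e = Poly_Mapping.map ((*) c) e"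

definition of_laurent :: "'k::field flaurent \<Rightarrow> 'k flaurent fract" where
  "of_laurent L = Fract L 1"

text \<open>
  A fractional rational function together with its indexed denominator factors:
  \<open>numer R / (\<Prod>j\<in>dens R. 1 - (y,\<Lambda>)^(dexp R j))\<close>. A factor \<open>1 - (u \<lambda>^b)^p\<close>
  is stored through the exponent vector of the whole monomial \<open>(u \<lambda>^b)^p\<close>.
\<close>

record (overloaded) 'k frat =
  numer :: "'k flaurent"
  dens :: "nat set"
  dexp :: "nat \<Rightarrow> exponent"

definition frat_val :: "'k::field frat \<Rightarrow> 'k flaurent fract" where
  "frat_val R = Fract (numer R) (\<Prod>j\<in>dens R. 1 - xpow (dexp R j))"

definition proper_frat :: "'k::field frat \<Rightarrow> bool" where
  "proper_frat R \<longleftrightarrow> finite (dens R) \<and> (\<forall>j\<in>dens R. dexp R j \<noteq> 0)"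


section \<open>The operators \<open>\<Z>\<close>\<close>

lift_definition Z_var :: "nat \<Rightarrow> 'k::field flaurent \<Rightarrow> 'k flaurent"
  is "\<lambda>v L e. if Poly_Mapping.lookup e v \<in> \<int> then L e else 0"
  by (rule finite_subset) auto

definition Z_y :: "nat \<Rightarrow> 'k::field flaurent \<Rightarrow> 'k flaurent" where
  "Z_y n = foldr Z_var [0..<n]"

definition clears :: "nat \<Rightarrow> 'k::field frat \<Rightarrow> (nat \<Rightarrow> nat) \<Rightarrow> bool" where
  "clears n R p \<longleftrightarrow>
    (\<forall>j\<in>dens R. 0 < p j \<and>
      (\<forall>v<n. Poly_Mapping.lookup (scale (of_nat (p j)) (dexp R j)) v \<in> \<int>))"

text \<open>
  The result of \<open>\<Z>\<^sub>y\<close> with its denominator factors \<open>1 - x\<^sub>j^(p j)\<close>. These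
  depend on the choice of \<open>p\<close>; the underlying rational function does not.
\<close>

definition Z_frat :: "nat \<Rightarrow> (nat \<Rightarrow> nat) \<Rightarrow> 'k::field frat \<Rightarrow> 'k frat" where
  "Z_frat n p R =
    \<lparr>numer = Z_y n (numer R * (\<Prod>j\<in>dens R. \<Sum>t<p j. xpow (dexp R j) ^ t)),
     dens = dens R,
     dexp = (\<lambda>j. scale (of_nat (p j)) (dexp R j))\<rparr>"

text \<open>
  \<open>\<Z>\<^sub>y\<close> on rational functions of the form \<open>L / (\<Prod>j. 1 - x\<^sub>j)\<close> with no distinguished
  denominator; independence of the presentation and of \<open>p\<close> is lemma \<open>Z_fract_frat_val\<close>.
\<close>

definition Z_fract :: "nat \<Rightarrow> 'k::field flaurent fract \<Rightarrow> 'k flaurent fract" where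
  "Z_fract n F =
    (THE G. \<exists>R p. proper_frat R \<and> clears n R p \<and> frat_val R = F \<and> frat_val (Z_frat n p R) = G)"


section \<open>The operator \<open>CT\<close>\<close>

text \<open>
  The substitution of \<open>\<lambda>^m\<close> for \<open>\<lambda>\<close>, where \<open>\<lambda>\<close> is variable \<open>v\<close>.
\<close>

definition stretch_exp :: "nat \<Rightarrow> nat \<Rightarrow> exponent \<Rightarrow> exponent" where
  "stretch_exp v m e = Poly_Mapping.update v (of_nat m * Poly_Mapping.lookup e v) e"

definition stretch_laurent :: "nat \<Rightarrow> nat \<Rightarrow> 'k::field flaurent \<Rightarrow> 'k flaurent" where
  "stretch_laurent v m L =
    (\<Sum>e\<in>Poly_Mapping.keys L. Poly_Mapping.single (stretch_exp v m e) (Poly_Mapping.lookup L e))"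

definition stretch :: "nat \<Rightarrow> nat \<Rightarrow> 'k::field frat \<Rightarrow> 'k frat" where
  "stretch v m R =
    \<lparr>numer = stretch_laurent v m (numer R),
     dens = dens R,
     dexp = (\<lambda>j. stretch_exp v m (dexp R j))\<rparr>"

definition integral_in :: "nat \<Rightarrow> 'k::field frat \<Rightarrow> bool" where
  "integral_in v R \<longleftrightarrow>
    (\<forall>e \<in> Poly_Mapping.keys (numer R) \<union> dexp R ` dens R. Poly_Mapping.lookup e v \<in> \<int>)"

definition free_of :: "nat \<Rightarrow> 'k::field flaurent fract \<Rightarrow> bool" where
  "free_of v F \<longleftrightarrow>
    (\<exists>a b. b \<noteq> 0 \<and> F = Fract a b \<and>
      (\<forall>e \<in> Poly_Mapping.keys a \<union> Poly_Mapping.keys b. Poly_Mapping.lookup e v = 0))"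

text \<open>
  \<open>1 - x = - x (1 - x\<^sup>-\<^sup>1)\<close> is applied when \<open>\<lambda>\<close> has negative exponent in \<open>x\<close>, so that every
  factor becomes \<open>1 - v \<lambda>^a\<close> with \<open>a \<ge> 0\<close>; this is the exponent vector of \<open>v \<lambda>^a\<close>.
\<close>

definition pos_exp :: "nat \<Rightarrow> exponent \<Rightarrow> exponent" where
  "pos_exp v e = (if Poly_Mapping.lookup e v < 0 then - e else e)"

text \<open>
  The partial fraction decomposition in \<open>\<lambda>\<close> (variable \<open>v\<close>) of a function with integral
  \<open>\<lambda>\<close>-exponents. Polynomials in \<open>\<lambda>\<close> have coefficients free of \<open>\<lambda>\<close> and are evaluated
  at \<open>\<lambda>\<close>, so \<open>poly (A j) 0\<close> is the constant term of \<open>A j\<close>.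
\<close>

definition partial_fractions ::
  "nat \<Rightarrow> 'k::field frat \<Rightarrow> 'k flaurent fract poly \<Rightarrow> 'k flaurent fract poly \<Rightarrow> nat \<Rightarrow>
    (nat \<Rightarrow> 'k flaurent fract poly) \<Rightarrow> bool" where
  "partial_fractions v R P q t A \<longleftrightarrow>
    (let lam = of_laurent (xpow (Poly_Mapping.single v 1));
         a = (\<lambda>l. Poly_Mapping.lookup (pos_exp v (dexp R l)) v);
         S = {l \<in> dens R. 0 < a l}
     in (\<forall>d. free_of v (coeff P d)) \<and> (\<forall>d. free_of v (coeff q d)) \<and> degree q < t \<and>
        (\<forall>l\<in>S. (\<forall>d. free_of v (coeff (A l) d)) \<and> of_nat (degree (A l)) < a l) \<and>
        frat_val R = poly P lam + poly q lam / lam ^ t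
          + (\<Sum>l\<in>S. poly (A l) lam / (1 - of_laurent (xpow (pos_exp v (dexp R l))))))"

text \<open>
  Meant for pairwise coprime denominator factors and for \<open>j\<close> with \<open>\<lambda>\<close> occurring in the
  \<open>j\<close>th factor; the value is then determined and independent of \<open>m\<close>. Otherwise it is
  unspecified.
\<close>

definition CT :: "nat \<Rightarrow> nat \<Rightarrow> 'k::field frat \<Rightarrow> 'k flaurent fract" where
  "CT v j R =
    (THE c. \<exists>m P q t A. 0 < m \<and> integral_in v (stretch v m R) \<and>
      partial_fractions v (stretch v m R) P q t A \<and> c = poly (A j) 0)"


section \<open>Matrix forms\<close>

definition start_mat :: "nat \<Rightarrow> nat \<Rightarrow> int mat \<Rightarrow> int vec \<Rightarrow> rat mat" where
  "start_mat n r A b =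
    four_block_mat (1\<^sub>m n) (0\<^sub>m n 1)
      (map_mat of_int A) (mat r 1 (\<lambda>(q, _). - of_int (b $ q)))"

definition pivot :: "nat \<Rightarrow> rat mat \<Rightarrow> nat \<Rightarrow> nat \<Rightarrow> rat mat" where
  "pivot n N i j = mat (dim_row N) (dim_col N)
    (\<lambda>(q, s). if s = j then N $$ (q, s)
              else N $$ (q, s) + (- N $$ (n + i, s) / N $$ (n + i, j)) * N $$ (q, j))"

text \<open>
  \<open>matrix_form n r M k I J N\<close>: \<open>N\<close> is a well-defined \<open>M\<^sub>k\<langle>I;J\<rangle>\<close>. Ignored rows and columns stay
  in \<open>N\<close> but are neither pivoted on again nor read off below.
\<close>

inductive matrix_form ::
  "nat \<Rightarrow> nat \<Rightarrow> rat mat \<Rightarrow> nat \<Rightarrow> nat set \<Rightarrow> nat set \<Rightarrow> rat mat \<Rightarrow> bool"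
  for n r :: nat and M :: "rat mat" where
  init: "matrix_form n r M 0 {} {} M"
| step: "matrix_form n r M k I J N \<Longrightarrow> i \<in> {..<r} - I \<Longrightarrow> j \<in> {..<n} - J \<Longrightarrow>
    N $$ (n + i, j) \<noteq> 0 \<Longrightarrow>
    matrix_form n r M (Suc k) (insert i I) (insert j J) (pivot n N i j)"

definition col_exp :: "nat \<Rightarrow> nat set \<Rightarrow> rat mat \<Rightarrow> nat \<Rightarrow> exponent" where
  "col_exp n I N s =
    (\<Sum>v \<in> {..<dim_row N} - (+) n ` I. Poly_Mapping.single v (N $$ (v, s)))"

definition mat_frat :: "nat \<Rightarrow> nat set \<Rightarrow> nat set \<Rightarrow> rat mat \<Rightarrow> 'k::field frat" where
  "mat_frat n I J N =
    \<lparr>numer = xpow (col_exp n I N n), dens = {..<n} - J, dexp = col_exp n I N\<rparr>"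


section \<open>\<open>\<Z>\<^sub>y\<close> is well defined on rational functions\<close>

lemma lookup_scale [simp]: "Poly_Mapping.lookup (scale c e) v = c * Poly_Mapping.lookup e v"
  unfolding scale_def by (simp add: Poly_Mapping.map.rep_eq when_def)

lemma lookup_Z_y:
  "Poly_Mapping.lookup (Z_y n L) e =
    (if \<forall>v<n. Poly_Mapping.lookup e v \<in> \<int> then Poly_Mapping.lookup L e else 0)"
proof (induction n arbitrary: L)
  case 0
  then show ?case by (simp add: Z_y_def)
next
  case (Suc n)
  have "Z_y (Suc n) L = Z_y n (Z_var n L)"
    by (simp add: Z_y_def)
  then show ?case
    by (auto simp: Suc Z_var.rep_eq less_Suc_eq)
qed

lemma Z_y_add: "Z_y n (K + L) = Z_y n K + Z_y n L"
  by (rule poly_mapping_eqI) (auto simp: lookup_Z_y lookup_add)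

lemma Z_y_idem_iff:
  "Z_y n L = L \<longleftrightarrow> (\<forall>e\<in>Poly_Mapping.keys L. \<forall>v<n. Poly_Mapping.lookup e v \<in> \<int>)"
  by (auto simp: poly_mapping_eq_iff fun_eq_iff lookup_Z_y in_keys_iff split: if_splits)

lemma Z_y_mult:
  assumes D: "Z_y n D = D"
  shows "Z_y n (L * D) = Z_y n L * D"
proof -
  have D': "\<forall>v<n. Poly_Mapping.lookup e v \<in> \<int>" if "e \<in> Poly_Mapping.keys D" for e
    using D that unfolding Z_y_idem_iff by blast
  define K where "K = L - Z_y n L"
  have 1: "Z_y n (Z_y n L * D) = Z_y n L * D"
    unfolding Z_y_idem_iff
  proof
    fix e assume "e \<in> Poly_Mapping.keys (Z_y n L * D)"
    then obtain a b where ab: "e = a + b" "a \<in> Poly_Mapping.keys (Z_y n L)" "b \<in> Poly_Mapping.keys D"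
      using keys_mult by blast
    then show "\<forall>v<n. Poly_Mapping.lookup e v \<in> \<int>"
      using D'[of b] by (auto simp: in_keys_iff lookup_Z_y lookup_add split: if_splits)
  qed
  have 2: "Z_y n (K * D) = 0"
  proof (rule poly_mapping_eqI)
    fix e
    show "Poly_Mapping.lookup (Z_y n (K * D)) e = Poly_Mapping.lookup 0 e"
    proof (rule ccontr)
      assume "\<not> ?thesis"
      then have e: "\<forall>v<n. Poly_Mapping.lookup e v \<in> \<int>" "e \<in> Poly_Mapping.keys (K * D)"
        by (auto simp: lookup_Z_y in_keys_iff split: if_splits)
      from e(2) obtain a b where ab: "e = a + b" "a \<in> Poly_Mapping.keys K" "b \<in> Poly_Mapping.keys D"
        using keys_mult by blast
      have "Poly_Mapping.lookup a v \<in> \<int>" if "v < n" for v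
        using e(1) D'[OF ab(3)] that Ints_diff[of "Poly_Mapping.lookup e v" "Poly_Mapping.lookup b v"]
        by (simp add: ab(1) lookup_add)
      with ab(2) show False
        by (simp add: K_def in_keys_iff lookup_minus lookup_Z_y)
    qed
  qed
  have "L * D = Z_y n L * D + K * D"
    by (simp add: K_def algebra_simps)
  then show ?thesis
    by (simp add: Z_y_add 1 2)
qed

lemma Z_y_mult_prod:
  assumes "finite S" "\<And>j. j \<in> S \<Longrightarrow> Z_y n (f j) = f j"
  shows "Z_y n (\<Prod>j\<in>S. f j) = (\<Prod>j\<in>S. f j)"
  using assms
proof (induction rule: finite_induct)
  case empty
  then show ?case by (simp add: Z_y_idem_iff)
next
  case (insert j S)
  then show ?case
    by (simp add: Z_y_mult mult.commute)
qed

lemma xpow_scale: "xpow (scale (of_nat p) e) = xpow e ^ p"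
proof (induction p)
  case 0
  have "scale 0 e = 0" by (rule poly_mapping_eqI) simp
  then show ?case by (simp add: xpow_def)
next
  case (Suc p)
  have "scale (of_nat (Suc p)) e = e + scale (of_nat p) e"
    by (rule poly_mapping_eqI) (simp add: lookup_add algebra_simps)
  moreover have "xpow (e + scale (of_nat p) e) = xpow e * (xpow (scale (of_nat p) e))"
    by (simp add: xpow_def mult_single)
  ultimately show ?case
    unfolding power_Suc Suc[symmetric] by (simp only:)
qed

lemma xpow_eq_1_iff [simp]: "xpow e = (1 :: 'k::field flaurent) \<longleftrightarrow> e = 0"
proof
  assume "xpow e = (1 :: 'k flaurent)"
  then have "Poly_Mapping.lookup (xpow e :: 'k flaurent) 0 = 1" by simp
  then show "e = 0" by (simp add: xpow_def lookup_single when_def split: if_splits)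
qed (simp add: xpow_def)

lemma clears_exists:
  assumes "finite (dens R)"
  shows "\<exists>p. clears n R p"
proof -
  have "\<exists>p. 0 < p \<and> (\<forall>v. of_nat p * Poly_Mapping.lookup e v \<in> \<int>)" for e :: exponent
  proof -
    define d where "d v = nat (snd (quotient_of (Poly_Mapping.lookup e v)))" for v
    have d: "0 < d v" for v
      using quotient_of_denom_pos'[of "Poly_Mapping.lookup e v"] by (simp add: d_def)
    have int: "of_nat (d v) * Poly_Mapping.lookup e v \<in> \<int>" for v
    proof -
      have "Poly_Mapping.lookup e v
          = of_int (fst (quotient_of (Poly_Mapping.lookup e v))) / of_nat (d v)"
        using quotient_of_div[of "Poly_Mapping.lookup e v"]
          quotient_of_denom_pos'[of "Poly_Mapping.lookup e v"]
        by (metis d_def less_imp_le of_int_of_nat_eq int_nat_eq prod.collapse)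
      then have "of_nat (d v) * Poly_Mapping.lookup e v
          = of_int (fst (quotient_of (Poly_Mapping.lookup e v)))"
        using d[of v] by (metis nonzero_mult_div_cancel_left of_nat_eq_0_iff less_irrefl times_divide_eq_right)
      then show ?thesis by simp
    qed
    let ?p = "\<Prod>v\<in>Poly_Mapping.keys e. d v"
    have "of_nat ?p * Poly_Mapping.lookup e v \<in> \<int>" for v
    proof (cases "v \<in> Poly_Mapping.keys e")
      case True
      then have "?p = (\<Prod>v\<in>Poly_Mapping.keys e - {v}. d v) * d v"
        by (simp add: prod.remove mult.commute)
      then have "of_nat ?p * Poly_Mapping.lookup e v
          = of_nat (\<Prod>v\<in>Poly_Mapping.keys e - {v}. d v) * (of_nat (d v) * Poly_Mapping.lookup e v)"
        by (simp only: of_nat_mult mult.assoc)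
      also have "\<dots> \<in> \<int>"
        by (rule Ints_mult[OF Ints_of_nat int])
      finally show ?thesis .
    next
      case False
      then show ?thesis by (simp add: in_keys_iff)
    qed
    moreover have "0 < ?p" using d by (simp add: prod_pos)
    ultimately show ?thesis by blast
  qed
  then have "\<exists>f. \<forall>e :: exponent. 0 < f e \<and> (\<forall>v. of_nat (f e) * Poly_Mapping.lookup e v \<in> \<int>)"
    by (intro choice) blast
  then obtain f where
    "\<forall>e :: exponent. 0 < f e \<and> (\<forall>v. of_nat (f e) * Poly_Mapping.lookup e v \<in> \<int>)" ..
  then show ?thesis
    by (intro exI[of _ "f \<circ> dexp R"]) (simp add: clears_def)
qed

lemma frat_val_cleared:
  fixes R :: "'k::field frat"
  assumes "proper_frat R" "clears n R p"
  defines "N \<equiv> numer R * (\<Prod>j\<in>dens R. \<Sum>t<p j. xpow (dexp R j) ^ t)"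
    and "D \<equiv> (\<Prod>j\<in>dens R. 1 - xpow (scale (of_nat (p j)) (dexp R j)))"
  shows "D \<noteq> 0" "Z_y n D = D" "frat_val R = Fract N D" "frat_val (Z_frat n p R) = Fract (Z_y n N) D"
proof -
  have fin: "finite (dens R)" using assms(1) by (simp add: proper_frat_def)
  have nz: "scale (of_nat (p j)) (dexp R j) \<noteq> 0" if j: "j \<in> dens R" for j
  proof
    assume 0: "scale (of_nat (p j)) (dexp R j) = 0"
    have "Poly_Mapping.lookup (dexp R j) v = 0" for v
      using arg_cong[OF 0, of "\<lambda>e. Poly_Mapping.lookup e v"] assms(2) j
      by (force simp: clears_def)
    then have "dexp R j = 0" by (intro poly_mapping_eqI) simp
    with assms(1) j show False by (simp add: proper_frat_def)
  qed
  show D0: "D \<noteq> 0"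
    using fin nz by (simp add: D_def)
  have D0': "(\<Prod>j\<in>dens R. 1 - xpow (dexp R j)) \<noteq> (0 :: 'k flaurent)"
    using assms(1) by (auto simp: proper_frat_def)
  show "Z_y n D = D"
    unfolding D_def
  proof (rule Z_y_mult_prod[OF fin])
    fix j assume "j \<in> dens R"
    then show "Z_y n (1 - xpow (scale (of_nat (p j)) (dexp R j))) =
        (1 - xpow (scale (of_nat (p j)) (dexp R j)) :: 'k flaurent)"
      using assms(2) unfolding Z_y_idem_iff clears_def
      by (auto simp: in_keys_iff lookup_minus lookup_one xpow_def lookup_single when_def
          simp del: lookup_scale split: if_splits)
  qed
  have "D = (\<Prod>j\<in>dens R. (1 - xpow (dexp R j)) * (\<Sum>t<p j. xpow (dexp R j) ^ t))"
    unfolding D_def xpow_scale by (intro prod.cong refl) (simp add: one_diff_power_eq)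
  then have "numer R * D = N * (\<Prod>j\<in>dens R. 1 - xpow (dexp R j))"
    by (simp only: N_def prod.distrib mult_ac)
  then show "frat_val R = Fract N D"
    using D0 D0' by (simp add: frat_val_def eq_fract)
  show "frat_val (Z_frat n p R) = Fract (Z_y n N) D"
    by (simp add: frat_val_def Z_frat_def N_def D_def)
qed

lemma Z_frat_cong:
  assumes "proper_frat R" "clears n R p" "proper_frat R'" "clears n R' p'"
    and "frat_val R = frat_val R'"
  shows "frat_val (Z_frat n p R) = frat_val (Z_frat n p' R')"
proof -
  note 1 = frat_val_cleared[OF assms(1,2)] and 2 = frat_val_cleared[OF assms(3,4)]
  from assms(5)
  have "numer R * (\<Prod>j\<in>dens R. \<Sum>t<p j. xpow (dexp R j) ^ t)
      * (\<Prod>j\<in>dens R'. 1 - xpow (scale (of_nat (p' j)) (dexp R' j)))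
    = numer R' * (\<Prod>j\<in>dens R'. \<Sum>t<p' j. xpow (dexp R' j) ^ t)
      * (\<Prod>j\<in>dens R. 1 - xpow (scale (of_nat (p j)) (dexp R j)))" (is "?N * ?D' = ?N' * ?D")
    unfolding 1(3) 2(3) using 1(1) 2(1) by (simp add: eq_fract)
  then have "Z_y n ?N * ?D' = Z_y n ?N' * ?D"
    using Z_y_mult[OF 1(2), of ?N'] Z_y_mult[OF 2(2), of ?N] by simp
  then show ?thesis
    unfolding 1(4) 2(4) using 1(1) 2(1) by (simp add: eq_fract)
qed

lemma Z_fract_frat_val:
  assumes "proper_frat R" "clears n R p"
  shows "Z_fract n (frat_val R) = frat_val (Z_frat n p R)"
  unfolding Z_fract_def
proof (rule the_equality)
  show "\<exists>R' p'. proper_frat R' \<and> clears n R' p' \<and> frat_val R' = frat_val R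
      \<and> frat_val (Z_frat n p' R') = frat_val (Z_frat n p R)"
    using assms by blast
qed (use Z_frat_cong assms in metis)

end

theory Submission
  imports Defs
begin

text \<open>
  \<open>\<Z>\<^sub>y\<close> is linear and does not touch \<open>\<lambda>\<close>, so it can be applied to the partial fraction
  decomposition term by term. It maps \<open>A\<^sub>l / (1 - x\<^sub>l)\<close> to
  \<open>\<Z>\<^sub>y(A\<^sub>l (1 + x\<^sub>l + \<dots> + x\<^sub>l^(p\<^sub>l - 1))) / (1 - x\<^sub>l^p\<^sub>l)\<close>, whose numerator again has smaller
  \<open>\<lambda>\<close>-degree than its denominator. The result is therefore the partial fraction decomposition of
  \<open>\<Z>\<^sub>y F\<close>, and the constant term of its \<open>j\<close>th numerator is \<open>\<Z>\<^sub>y(A\<^sub>j(0))\<close> because \<open>x\<^sub>l\<close> vanishes at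
  \<open>\<lambda> = 0\<close>. For \<open>\<Z>\<^sub>y\<close> to be defined on the coefficients, the decomposition has to exist over the
  ring of \<open>\<lambda>\<close>-free fractions \<open>L / \<Prod>(1 - x^e)\<close>; there it comes from explicit Bezout identities
  between the denominator factors.
\<close>


section \<open>Subrings\<close>

text \<open>\<open>CT\<close> is a definite description over all \<open>m\<close> and over all
  decompositions whose coefficients are merely \<open>free_of\<close>. One explicit decomposition
  therefore gives its value only together with uniqueness over that large coefficient ring, where
  \<open>Z_fract\<close> need not have a value, while existence is needed over the smaller ring of
  binomial fractions. Two choices of \<open>m\<close> are compared by passing to their product.

  Coprimality over the field of \<lambda>-free fractions would yield Bezout coefficients with
  uncontrolled denominators. The working condition is instead that no two exponent vectors of
  denominator factors are proportional. It survives powers, sign changes and the substitution of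
  \<lambda>^m, and it makes one particular \<lambda>-free binomial nonzero, which is the only
  element that the Bezout identity has to invert. Matrix forms satisfy it because each remaining
  y-variable occurs in its own denominator factor alone.\<close>

definition is_subring :: "'a::comm_ring_1 set \<Rightarrow> bool" where
  "is_subring C \<longleftrightarrow> 0 \<in> C \<and> 1 \<in> C \<and> (\<forall>x\<in>C. - x \<in> C) \<and> (\<forall>x\<in>C. \<forall>y\<in>C. x + y \<in> C \<and> x * y \<in> C)"

lemma is_subringI:
  assumes "0 \<in> C" "1 \<in> C" "\<And>x. x \<in> C \<Longrightarrow> - x \<in> C"
    and "\<And>x y. x \<in> C \<Longrightarrow> y \<in> C \<Longrightarrow> x + y \<in> C" "\<And>x y. x \<in> C \<Longrightarrow> y \<in> C \<Longrightarrow> x * y \<in> C"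
  shows "is_subring C"
  using assms by (auto simp: is_subring_def)

context
  fixes C :: "'a::comm_ring_1 set"
  assumes C: "is_subring C"
begin

lemma subring_zero: "0 \<in> C" and subring_one: "1 \<in> C"
  and subring_uminus: "x \<in> C \<Longrightarrow> - x \<in> C"
  and subring_add: "x \<in> C \<Longrightarrow> y \<in> C \<Longrightarrow> x + y \<in> C"
  and subring_mult: "x \<in> C \<Longrightarrow> y \<in> C \<Longrightarrow> x * y \<in> C"
  using C by (auto simp: is_subring_def)

lemma subring_diff: "x \<in> C \<Longrightarrow> y \<in> C \<Longrightarrow> x - y \<in> C"
  using subring_add[of x "- y"] subring_uminus by simp

lemma subring_power: "x \<in> C \<Longrightarrow> x ^ d \<in> C"
  by (induction d) (auto intro: subring_one subring_mult)

lemma subring_sum: "(\<And>l. l \<in> S \<Longrightarrow> f l \<in> C) \<Longrightarrow> sum f S \<in> C"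
  by (induction S rule: infinite_finite_induct) (auto intro: subring_zero subring_add)

lemma subring_prod: "(\<And>l. l \<in> S \<Longrightarrow> f l \<in> C) \<Longrightarrow> prod f S \<in> C"
  by (induction S rule: infinite_finite_induct) (auto intro: subring_one subring_mult)

lemmas subring_intros = subring_zero subring_one subring_uminus subring_add subring_mult
  subring_diff subring_power subring_sum subring_prod

end

text \<open>Inside a field and for nonzero \<open>z\<close> this set is the localization
  \<open>C[1/z]\<close>. It is applied with \<open>z = lam v\<close>, so that monomials with
  negative integral \<lambda>-exponent can be handled inside a ring.\<close>

lemma subring_localization:
  assumes C: "is_subring C" and z: "z \<in> C"
  shows "is_subring {x. \<exists>d. z ^ d * x \<in> C}"
proof (rule is_subringI)
  fix x y assume "x \<in> {x. \<exists>d. z ^ d * x \<in> C}" "y \<in> {x. \<exists>d. z ^ d * x \<in> C}"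
  then obtain d e where d: "z ^ d * x \<in> C" and e: "z ^ e * y \<in> C" by blast
  have "z ^ e * (z ^ d * x) + z ^ d * (z ^ e * y) \<in> C" "(z ^ d * x) * (z ^ e * y) \<in> C"
    by (intro subring_intros[OF C] z d e)+
  moreover have "z ^ e * (z ^ d * x) + z ^ d * (z ^ e * y) = z ^ (d + e) * (x + y)"
    "(z ^ d * x) * (z ^ e * y) = z ^ (d + e) * (x * y)"
    by (simp_all add: power_add algebra_simps)
  ultimately show "x + y \<in> {x. \<exists>d. z ^ d * x \<in> C}" "x * y \<in> {x. \<exists>d. z ^ d * x \<in> C}"
    by (metis mem_Collect_eq)+
next
  fix x assume "x \<in> {x. \<exists>d. z ^ d * x \<in> C}"
  then obtain d where "z ^ d * x \<in> C" by blast
  then have "z ^ d * (- x) \<in> C" using subring_uminus[OF C] by simp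
  then show "- x \<in> {x. \<exists>d. z ^ d * x \<in> C}" by blast
qed (use subring_intros[OF C] in \<open>auto intro!: exI[of _ 0]\<close>)

definition fractions :: "'a::idom set \<Rightarrow> 'a set \<Rightarrow> 'a fract set" where
  "fractions L D = {Fract a d | a d. a \<in> L \<and> d \<in> D}"

lemma Fract_in_fractions: "a \<in> L \<Longrightarrow> d \<in> D \<Longrightarrow> Fract a d \<in> fractions L D"
  by (auto simp: fractions_def)

lemma subring_fractions:
  assumes L: "is_subring L" and D: "D \<subseteq> L" "1 \<in> D" "0 \<notin> D"
    and mult: "\<And>x y. x \<in> D \<Longrightarrow> y \<in> D \<Longrightarrow> x * y \<in> D"
  shows "is_subring (fractions L D)"
proof (rule is_subringI)
  show "0 \<in> fractions L D"
    unfolding Zero_fract_def by (intro Fract_in_fractions subring_zero[OF L] D)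
  show "1 \<in> fractions L D"
    unfolding One_fract_def by (intro Fract_in_fractions subring_one[OF L] D)
next
  fix x assume "x \<in> fractions L D"
  then show "- x \<in> fractions L D"
    by (fastforce simp: fractions_def intro: subring_uminus[OF L])
next
  fix x y assume "x \<in> fractions L D" "y \<in> fractions L D"
  then obtain a d b e where x: "x = Fract a d" "a \<in> L" "d \<in> D" and y: "y = Fract b e" "b \<in> L" "e \<in> D"
    by (auto simp: fractions_def)
  have [simp]: "d \<noteq> 0" "e \<noteq> 0" using x y D by auto
  show "x + y \<in> fractions L D" "x * y \<in> fractions L D"
    unfolding x y add_fract[OF \<open>d \<noteq> 0\<close> \<open>e \<noteq> 0\<close>] mult_fract using x y D(1)
    by (auto intro!: Fract_in_fractions subring_intros[OF L] mult)
qed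


section \<open>Polynomials over a subring and their values\<close>

definition polys :: "'a::comm_ring_1 set \<Rightarrow> 'a poly set" where
  "polys C = {p. \<forall>d. coeff p d \<in> C}"

lemma subring_polys:
  assumes C: "is_subring C"
  shows "is_subring (polys C)"
proof (rule is_subringI)
  show "p * q \<in> polys C" if "p \<in> polys C" "q \<in> polys C" for p q
    using that by (auto simp: polys_def coeff_mult intro!: subring_intros[OF C])
qed (auto simp: polys_def intro: subring_intros[OF C])

lemma pCons_in_polys_iff: "pCons c p \<in> polys C \<longleftrightarrow> c \<in> C \<and> p \<in> polys C"
  unfolding polys_def mem_Collect_eq
proof (intro iffI conjI allI)
  assume *: "\<forall>d. coeff (pCons c p) d \<in> C"
  show "c \<in> C" using *[rule_format, of 0] by simp
  show "coeff p d \<in> C" for d using *[rule_format, of "Suc d"] by simp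
qed (auto simp: coeff_pCons split: nat.split)

lemma monom_in_polys: "is_subring C \<Longrightarrow> c \<in> C \<Longrightarrow> monom c d \<in> polys C"
  by (auto simp: polys_def subring_zero)

lemma smult_in_polys: "is_subring C \<Longrightarrow> c \<in> C \<Longrightarrow> p \<in> polys C \<Longrightarrow> smult c p \<in> polys C"
  by (auto simp: polys_def subring_mult)

lemma pcompose_in_polys:
  assumes C: "is_subring C" and "p \<in> polys C" "q \<in> polys C"
  shows "pcompose p q \<in> polys C"
  using assms(2)
proof (induction p)
  case 0
  then show ?case by simp
next
  case (pCons c p)
  then show ?case
    using assms(3) subring_zero[OF subring_polys[OF C]]
    by (auto simp: pcompose_pCons pCons_in_polys_iff intro!: subring_intros[OF subring_polys[OF C]])
qed

text \<open>Division by \<open>f\<close> stays inside \<open>C\<close> because the leading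
  coefficient of \<open>f\<close> is a unit there. Passing from \<open>h\<close> to
  \<open>pCons c h\<close> multiplies by the variable and adds a constant, so the old remainder
  grows by at most one degree and a single subtraction repairs it.\<close>

lemma polys_division:
  fixes f :: "'a::field poly"
  assumes C: "is_subring C" and f: "f \<in> polys C" "0 < degree f" "inverse (lead_coeff f) \<in> C"
    and h: "h \<in> polys C"
  shows "\<exists>s A. s \<in> polys C \<and> A \<in> polys C \<and> degree A < degree f \<and> h = s * f + A"
  using h
proof (induction h)
  case 0
  then show ?case using f by (intro exI[of _ 0]) auto
next
  case (pCons c h)
  then obtain s A where A: "s \<in> polys C" "A \<in> polys C" "degree A < degree f" "h = s * f + A"
    by (auto simp: pCons_in_polys_iff)
  \<comment> \<open>\<open>pCons c A\<close> may reach the degree of \<open>f\<close>;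
    \<open>\<beta>\<close> is chosen so that \<open>smult \<beta> f\<close> cancels that one
    coefficient.\<close>
  define \<beta> where "\<beta> = coeff (pCons c A) (degree f) * inverse (lead_coeff f)"
  define B where "B = pCons c A - smult \<beta> f"
  have cA: "pCons c A \<in> polys C" using A pCons.prems by (simp add: pCons_in_polys_iff)
  have \<beta>: "\<beta> \<in> C" using cA f unfolding \<beta>_def polys_def by (auto intro: subring_mult[OF C])
  have lc: "lead_coeff f \<noteq> 0" using f(2) by auto
  have "degree B \<le> degree f"
    unfolding B_def using A(3) degree_pCons_le[of c A] by (intro degree_diff_le) auto
  moreover have "coeff B (degree f) = 0"
    using lc by (simp add: B_def \<beta>_def)
  ultimately have "degree B < degree f"
    using f(2) by (metis degree_0 le_neq_implies_less leading_coeff_0_iff)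
  moreover have "pCons c h = pCons \<beta> s * f + B"
    by (simp add: A(4) B_def)
  moreover have "B \<in> polys C"
    unfolding B_def by (intro subring_diff[OF subring_polys[OF C]] cA smult_in_polys[OF C] \<beta> f)
  ultimately show ?case
    using A \<beta> by (intro exI[of _ "pCons \<beta> s"] exI[of _ B]) (simp add: pCons_in_polys_iff)
qed

text \<open>This is the ring \<open>C[x]\<close>, without any claim that the polynomial is
  determined by its value; for \<lambda> that is \<open>lam_transcendental\<close>.\<close>

definition values_at :: "'a::comm_ring_1 \<Rightarrow> 'a set \<Rightarrow> 'a set" where
  "values_at x C = (\<lambda>p. poly p x) ` polys C"

lemma subring_values_at:
  assumes "is_subring C"
  shows "is_subring (values_at x C)"
proof -
  note P = subring_polys[OF assms]
  show ?thesis
  proof (rule is_subringI)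
    show "0 \<in> values_at x C" unfolding values_at_def
      by (rule image_eqI[of _ _ 0]) (auto intro: subring_zero[OF P])
    show "1 \<in> values_at x C" unfolding values_at_def
      by (rule image_eqI[of _ _ 1]) (auto intro: subring_one[OF P])
  next
    fix y assume "y \<in> values_at x C"
    then obtain p where "p \<in> polys C" "y = poly p x" by (auto simp: values_at_def)
    then show "- y \<in> values_at x C" unfolding values_at_def
      by (intro image_eqI[of _ _ "- p"]) (auto intro: subring_uminus[OF P])
  next
    fix y z assume "y \<in> values_at x C" "z \<in> values_at x C"
    then obtain p q where "p \<in> polys C" "y = poly p x" "q \<in> polys C" "z = poly q x"
      by (auto simp: values_at_def)
    then show "y + z \<in> values_at x C" "y * z \<in> values_at x C" unfolding values_at_def
      by (auto intro: image_eqI[of _ _ "p + q"] image_eqI[of _ _ "p * q"] subring_intros[OF P])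
  qed
qed

lemma poly_in_values_at: "p \<in> polys C \<Longrightarrow> poly p x \<in> values_at x C"
  by (simp add: values_at_def)

lemma values_at_mono: "C \<subseteq> D \<Longrightarrow> values_at x C \<subseteq> values_at x D"
  by (auto simp: values_at_def polys_def)

lemma const_in_values_at:
  assumes C: "is_subring C" and "c \<in> C"
  shows "c \<in> values_at x C"
  using poly_in_values_at[OF monom_in_polys[OF assms, of 0], of x] by (simp add: poly_monom)

lemma point_in_values_at:
  assumes C: "is_subring C"
  shows "x \<in> values_at x C"
  using poly_in_values_at[OF monom_in_polys[OF C subring_one[OF C], of 1], of x]
  by (simp add: poly_monom)


section \<open>Partial fractions over comaximal denominators\<close>

text \<open>The coefficients are required to lie in \<open>C\<close>. This is stronger than
  coprimality over the field of fractions, and it keeps numerators in \<open>C\<close> when a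
  fraction is split.\<close>

definition comaximal :: "'a::comm_ring_1 set \<Rightarrow> 'a \<Rightarrow> 'a \<Rightarrow> bool" where
  "comaximal C x y \<longleftrightarrow> (\<exists>u\<in>C. \<exists>w\<in>C. u * x + w * y = 1)"

lemma comaximal_mono: "comaximal C x y \<Longrightarrow> C \<subseteq> D \<Longrightarrow> comaximal D x y"
  unfolding comaximal_def by blast

lemma comaximal_one: "is_subring C \<Longrightarrow> comaximal C x 1"
  unfolding comaximal_def by (intro bexI[of _ 0] bexI[of _ 1]) (auto intro: subring_zero subring_one)

text \<open>In the product of the two Bezout identities, every term except
  \<open>b * d * (y * z)\<close> contains the factor \<open>x\<close>.\<close>

lemma comaximal_mult:
  assumes C: "is_subring C" and "x \<in> C" "y \<in> C" "z \<in> C" "comaximal C x y" "comaximal C x z"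
  shows "comaximal C x (y * z)"
proof -
  from assms obtain a b c d where *: "a \<in> C" "b \<in> C" "c \<in> C" "d \<in> C" "a * x + b * y = 1" "c * x + d * z = 1"
    unfolding comaximal_def by blast
  have "1 = (a * x + b * y) * (c * x + d * z)" using * by simp
  also have "\<dots> = (a * (c * x + d * z) + b * y * c) * x + (b * d) * (y * z)"
    by (simp add: algebra_simps)
  finally show ?thesis
    using * assms unfolding comaximal_def
    by (intro bexI[of _ "a * (c * x + d * z) + b * y * c"] bexI[of _ "b * d"])
      (auto intro!: subring_intros[OF C])
qed

lemma comaximal_prod:
  assumes C: "is_subring C" and "x \<in> C" "\<And>l. l \<in> S \<Longrightarrow> g l \<in> C" "\<And>l. l \<in> S \<Longrightarrow> comaximal C x (g l)"
  shows "comaximal C x (prod g S)"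
  using assms(3,4)
proof (induction S rule: infinite_finite_induct)
  case (insert l S)
  then show ?case
    by (auto intro!: comaximal_mult[OF C] subring_prod[OF C] assms(2))
qed (auto intro: comaximal_one[OF C])

lemma comaximal_power:
  assumes C: "is_subring C" and "x \<in> C" "y \<in> C" "comaximal C x y"
  shows "comaximal C x (y ^ d)"
  by (induction d) (auto intro!: comaximal_one[OF C] comaximal_mult[OF C] subring_power[OF C] assms)

lemma comaximal_sym: "comaximal C x y \<Longrightarrow> comaximal C y x"
  unfolding comaximal_def by (metis add.commute)

text \<open>A Bezout identity for \<open>x\<close> and \<open>g l\<close> splits
  \<open>y / (x * g l)\<close> into fractions over \<open>x\<close> and over \<open>g l\<close>;
  adding a factor \<open>g l\<close> applies this to every existing summand. The denominator
  \<open>d\<close> is kept apart because it will be a power of \<lambda>. Degrees are not controlled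
  here; they are reduced afterwards by \<open>polys_division\<close>.\<close>

lemma comaximal_split:
  fixes g :: "'i \<Rightarrow> 'a::field"
  assumes C: "is_subring C" and "finite S" and "d \<noteq> 0" "H \<in> C"
    and "\<And>l. l \<in> S \<Longrightarrow> g l \<noteq> 0"
    and "\<And>l. l \<in> S \<Longrightarrow> comaximal C d (g l)"
    and "\<And>l l'. l \<in> S \<Longrightarrow> l' \<in> S \<Longrightarrow> l \<noteq> l' \<Longrightarrow> comaximal C (g l) (g l')"
  shows "\<exists>h0 h. h0 \<in> C \<and> (\<forall>l\<in>S. h l \<in> C) \<and> H / (d * prod g S) = h0 / d + (\<Sum>l\<in>S. h l / g l)"
  using assms(2,5-)
proof (induction S rule: finite_induct)
  case empty
  then show ?case using assms(4) by auto
next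
  case (insert l S)
  have split: "\<exists>u\<in>C. \<exists>w\<in>C. y / (x * g l) = u / x + w / g l"
    if "x \<noteq> 0" "y \<in> C" "comaximal C x (g l)" for x y
  proof -
    from that(3) obtain u w where uw: "u \<in> C" "w \<in> C" "u * x + w * g l = 1"
      unfolding comaximal_def by blast
    have "y / (x * g l) = y * (u * x + w * g l) / (x * g l)" by (simp add: uw)
    also have "\<dots> = y * w / x + y * u / g l"
      using that(1) insert.prems(1)[of l] by (simp add: field_simps)
    finally show ?thesis using uw that by (metis subring_mult[OF C])
  qed
  from insert obtain h0 h where h: "h0 \<in> C" "\<forall>l\<in>S. h l \<in> C"
    "H / (d * prod g S) = h0 / d + (\<Sum>l\<in>S. h l / g l)"
    by (auto simp: Ball_def)
  obtain k0 w0 where k0: "k0 \<in> C" "w0 \<in> C" "h0 / (d * g l) = k0 / d + w0 / g l"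
    using split[OF assms(3) h(1)] insert.prems by auto
  have "\<forall>i\<in>S. \<exists>k w. k \<in> C \<and> w \<in> C \<and> h i / (g i * g l) = k / g i + w / g l"
    using split h(2) insert.prems insert.hyps by (metis insertI1 insertI2)
  then obtain k w where kw: "\<forall>i\<in>S. k i \<in> C \<and> w i \<in> C \<and> h i / (g i * g l) = k i / g i + w i / g l"
    by metis
  \<comment> \<open>Splitting each summand leaves a piece over \<open>g l\<close>. All these pieces
    together form the numerator at the new index.\<close>
  define K where "K = k(l := w0 + (\<Sum>i\<in>S. w i))"
  have "H / (d * prod g (insert l S)) = (H / (d * prod g S)) / g l"
    using insert.hyps by (simp add: mult_ac)
  also have "\<dots> = h0 / (d * g l) + (\<Sum>i\<in>S. h i / (g i * g l))"
    by (simp add: h(3) add_divide_distrib sum_divide_distrib)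
  also have "\<dots> = k0 / d + w0 / g l + (\<Sum>i\<in>S. k i / g i + w i / g l)"
    using kw by (simp add: k0(3))
  also have "\<dots> = k0 / d + ((w0 + (\<Sum>i\<in>S. w i)) / g l + (\<Sum>i\<in>S. k i / g i))"
    by (simp add: sum.distrib add_divide_distrib sum_divide_distrib)
  also have "\<dots> = k0 / d + (\<Sum>i\<in>insert l S. K i / g i)"
  proof -
    have "(\<Sum>i\<in>S. K i / g i) = (\<Sum>i\<in>S. k i / g i)"
      using insert.hyps by (intro sum.cong) (auto simp: K_def)
    then show ?thesis using insert.hyps by (simp add: K_def)
  qed
  moreover have "\<forall>i\<in>insert l S. K i \<in> C"
    using kw k0 by (auto simp: K_def intro!: subring_intros[OF C])
  ultimately show ?case using k0(1) by metis
qed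

text \<open>The \<open>B l\<close> will be differences of numerators of two decompositions. By the
  equation, \<open>B j / g j\<close> multiplied by all other denominators lies in \<open>C\<close>;
  multiplied by \<open>g j\<close> it is \<open>B j\<close>, again in \<open>C\<close>. Since these
  two multipliers are comaximal, \<open>B j / g j\<close> itself lies in \<open>C\<close>.\<close>

lemma partial_fraction_integral:
  fixes g :: "'i \<Rightarrow> 'a::field"
  assumes C: "is_subring C" and fin: "finite S" and j: "j \<in> S" and "d \<in> C" "d \<noteq> 0" "H \<in> C"
    and g: "\<And>l. l \<in> S \<Longrightarrow> g l \<in> C" "\<And>l. l \<in> S \<Longrightarrow> g l \<noteq> 0" and B: "\<And>l. l \<in> S \<Longrightarrow> B l \<in> C"
    and "comaximal C (g j) d" and "\<And>l. l \<in> S \<Longrightarrow> l \<noteq> j \<Longrightarrow> comaximal C (g j) (g l)"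
    and eq: "H / d + (\<Sum>l\<in>S. B l / g l) = 0"
  shows "B j / g j \<in> C"
proof -
  define D where "D = d * prod g (S - {j})"
  have "comaximal C (g j) D"
    unfolding D_def using assms by (intro comaximal_mult[OF C] comaximal_prod[OF C] subring_prod[OF C]) auto
  then obtain u w where uw: "u \<in> C" "w \<in> C" "u * g j + w * D = 1"
    unfolding comaximal_def by blast
  have "B l / g l * D \<in> C" if l: "l \<in> S - {j}" for l
  proof -
    have "D = g l * (d * prod g (S - {j} - {l}))"
      unfolding D_def using l fin by (subst prod.remove[of _ l]) auto
    then have "B l / g l * D = B l * (d * prod g (S - {j} - {l}))"
      using g(2)[of l] l by simp
    then show ?thesis
      using assms l by (auto intro!: subring_intros[OF C])
  qed
  moreover have "H / d * D \<in> C"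
    using assms by (auto simp: D_def intro!: subring_intros[OF C])
  moreover have "B j / g j = - (H / d + (\<Sum>l\<in>S - {j}. B l / g l))"
    using eq sum.remove[OF fin j, of "\<lambda>l. B l / g l"] by (simp add: add_eq_0_iff algebra_simps)
  then have "B j / g j * D = - (H / d * D + (\<Sum>l\<in>S - {j}. B l / g l * D))"
    by (simp only: minus_mult_left [symmetric] distrib_right sum_distrib_right)
  ultimately have *: "B j / g j * D \<in> C"
    by (auto intro!: subring_intros[OF C])
  have "B j / g j = (B j / g j) * (u * g j + w * D)" by (simp add: uw)
  also have "\<dots> = u * B j + w * (B j / g j * D)"
    using g(2)[OF j] by (simp add: field_simps)
  also have "\<dots> \<in> C"
    by (intro subring_add[OF C] subring_mult[OF C] uw * B j)
  finally show ?thesis .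
qed


section \<open>Exponents and substitution of powers\<close>

lemma lookup_stretch_exp:
  "Poly_Mapping.lookup (stretch_exp v m e) w
    = (if w = v then of_nat m else 1) * Poly_Mapping.lookup e w"
  by (simp add: stretch_exp_def Poly_Mapping.lookup_update)

lemma stretch_exp_zero [simp]: "stretch_exp v m 0 = 0"
  by (rule poly_mapping_eqI) (simp add: lookup_stretch_exp)

lemma stretch_exp_add: "stretch_exp v m (e + f) = stretch_exp v m e + stretch_exp v m f"
  by (rule poly_mapping_eqI) (simp add: lookup_stretch_exp lookup_add algebra_simps)

lemma stretch_exp_uminus: "stretch_exp v m (- e) = - stretch_exp v m e"
  by (rule poly_mapping_eqI) (simp add: lookup_stretch_exp)

lemma stretch_exp_scale: "stretch_exp v m (scale c e) = scale c (stretch_exp v m e)"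
  by (rule poly_mapping_eqI) (simp add: lookup_stretch_exp)

lemma stretch_exp_stretch_exp: "stretch_exp v m (stretch_exp v m' e) = stretch_exp v (m * m') e"
  by (rule poly_mapping_eqI) (simp add: lookup_stretch_exp)

lemma stretch_exp_eq_iff: "0 < m \<Longrightarrow> stretch_exp v m e = stretch_exp v m f \<longleftrightarrow> e = f"
  by (auto simp: poly_mapping_eq_iff fun_eq_iff lookup_stretch_exp split: if_splits)

lemma stretch_exp_free: "Poly_Mapping.lookup e v = 0 \<Longrightarrow> stretch_exp v m e = e"
  by (rule poly_mapping_eqI) (simp add: lookup_stretch_exp)

lemma pos_exp_stretch_exp: "0 < m \<Longrightarrow> pos_exp v (stretch_exp v m e) = stretch_exp v m (pos_exp v e)"
  by (simp add: pos_exp_def lookup_stretch_exp stretch_exp_uminus mult_less_0_iff)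

lemma pos_exp_scale: "0 < c \<Longrightarrow> pos_exp v (scale c e) = scale c (pos_exp v e)"
  by (rule poly_mapping_eqI) (simp add: pos_exp_def mult_less_0_iff)

lemma pos_exp_cases:
  obtains "pos_exp v e = e" | "pos_exp v e = - e"
  by (cases "Poly_Mapping.lookup e v < 0") (auto simp: pos_exp_def)

lemma scale_scale: "scale c (scale d e) = scale (c * d) e"
  by (rule poly_mapping_eqI) simp

text \<open>With \<open>s\<close> equal to 1 or -1 the sign change becomes a scaling, which
  \<open>coprime_dens\<close> tolerates.\<close>

lemma pos_exp_eq_scale: "\<exists>s. s \<noteq> 0 \<and> pos_exp v e = scale s e"
proof -
  have "e = scale 1 e" "- e = scale (- 1) e" by (rule poly_mapping_eqI; simp)+
  then show ?thesis using pos_exp_cases by (metis neg_equal_0_iff_equal zero_neq_one)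
qed

lemma lookup_pos_exp: "Poly_Mapping.lookup (pos_exp v e) v = \<bar>Poly_Mapping.lookup e v\<bar>"
  by (simp add: pos_exp_def)

section \<open>Substitution of powers in Laurent polynomials\<close>

lemma laurent_eq_sum_single:
  fixes L :: "'k::field flaurent"
  assumes "finite T" "Poly_Mapping.keys L \<subseteq> T"
  shows "L = (\<Sum>e\<in>T. Poly_Mapping.single e (Poly_Mapping.lookup L e))"
proof (rule poly_mapping_eqI)
  fix f
  show "Poly_Mapping.lookup L f
      = Poly_Mapping.lookup (\<Sum>e\<in>T. Poly_Mapping.single e (Poly_Mapping.lookup L e)) f"
    using assms by (auto simp: lookup_sum lookup_single when_def in_keys_iff subset_iff)
qed

text \<open>Reduces additive statements to single terms. The coefficient \<open>c\<close> may be 0,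
  so the zero polynomial needs no case of its own.\<close>

lemma laurent_induct [case_names single add]:
  fixes L :: "'k::field flaurent"
  assumes "\<And>e c. P (Poly_Mapping.single e c)" "\<And>K L. P K \<Longrightarrow> P L \<Longrightarrow> P (K + L)"
  shows "P L"
proof -
  have "P (\<Sum>e\<in>T. Poly_Mapping.single e (Poly_Mapping.lookup L e))" if "finite T" for T
    using that assms(1)[of 0 0] by (induction T rule: finite_induct) (auto intro: assms)
  then have "P (\<Sum>e\<in>Poly_Mapping.keys L. Poly_Mapping.single e (Poly_Mapping.lookup L e))" by simp
  then show ?thesis using laurent_eq_sum_single[of "Poly_Mapping.keys L" L] by simp
qed

text \<open>Lets two polynomials and their sum be expanded over one common set of exponents,
  although cancellation may shrink the keys of the sum.\<close>

lemma stretch_laurent_superset: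
  assumes "finite T" "Poly_Mapping.keys L \<subseteq> T"
  shows "stretch_laurent v m L
    = (\<Sum>e\<in>T. Poly_Mapping.single (stretch_exp v m e) (Poly_Mapping.lookup L e))"
  unfolding stretch_laurent_def using assms
  by (intro sum.mono_neutral_left) (auto simp: in_keys_iff)

lemma stretch_laurent_single [simp]:
  "stretch_laurent v m (Poly_Mapping.single e c) = Poly_Mapping.single (stretch_exp v m e) c"
  by (subst stretch_laurent_superset[of "{e}"]) auto

lemma stretch_laurent_add:
  "stretch_laurent v m (K + L) = stretch_laurent v m K + stretch_laurent v m L"
  using Poly_Mapping.keys_add[of K L]
  by (simp add: stretch_laurent_superset[of "Poly_Mapping.keys K \<union> Poly_Mapping.keys L"]
      lookup_add single_add sum.distrib)

lemma stretch_laurent_zero [simp]: "stretch_laurent v m 0 = 0"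
  by (simp add: stretch_laurent_def)

lemma stretch_laurent_one [simp]: "stretch_laurent v m 1 = 1"
  by (simp flip: single_one)

lemma stretch_laurent_uminus: "stretch_laurent v m (- L) = - stretch_laurent v m L"
  using stretch_laurent_add[of v m L "- L"] by (simp add: eq_neg_iff_add_eq_0 add.commute)

lemma stretch_laurent_diff:
  "stretch_laurent v m (K - L) = stretch_laurent v m K - stretch_laurent v m L"
  using stretch_laurent_add[of v m K "- L"] by (simp add: stretch_laurent_uminus)

lemma stretch_laurent_mult:
  "stretch_laurent v m (K * L) = stretch_laurent v m K * stretch_laurent v m L"
proof (induction K rule: laurent_induct)
  case (single e c)
  show ?case
    by (induction L rule: laurent_induct)
      (simp_all add: mult_single stretch_exp_add stretch_laurent_add distrib_left)
qed (simp add: stretch_laurent_add distrib_right)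

lemma stretch_laurent_sum:
  "stretch_laurent v m (\<Sum>x\<in>S. f x) = (\<Sum>x\<in>S. stretch_laurent v m (f x))"
  by (induction S rule: infinite_finite_induct) (auto simp: stretch_laurent_add)

lemma stretch_laurent_prod:
  "stretch_laurent v m (\<Prod>x\<in>S. f x) = (\<Prod>x\<in>S. stretch_laurent v m (f x))"
  by (induction S rule: infinite_finite_induct) (auto simp: stretch_laurent_mult)

lemma stretch_laurent_power: "stretch_laurent v m (L ^ d) = stretch_laurent v m L ^ d"
  by (induction d) (auto simp: stretch_laurent_mult)

lemma stretch_laurent_xpow [simp]: "stretch_laurent v m (xpow e) = xpow (stretch_exp v m e)"
  by (simp add: xpow_def)

lemma stretch_laurent_stretch_laurent:
  "stretch_laurent v m (stretch_laurent v m' L) = stretch_laurent v (m * m') L"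
  by (induction L rule: laurent_induct) (simp_all add: stretch_laurent_add stretch_exp_stretch_exp)

text \<open>For positive \<open>m\<close> the map on exponents is injective, so stretching only
  relabels terms and never merges them.\<close>

lemma lookup_stretch_laurent:
  assumes "0 < m"
  shows "Poly_Mapping.lookup (stretch_laurent v m L) (stretch_exp v m e) = Poly_Mapping.lookup L e"
  by (induction L rule: laurent_induct)
    (simp_all add: stretch_laurent_add lookup_add lookup_single stretch_exp_eq_iff[OF assms])

lemma stretch_laurent_eq_0_iff: "0 < m \<Longrightarrow> stretch_laurent v m L = 0 \<longleftrightarrow> L = 0"
  by (metis lookup_stretch_laurent lookup_zero poly_mapping_eqI stretch_laurent_zero)

lemma stretch_laurent_free:
  assumes "\<And>e. e \<in> Poly_Mapping.keys L \<Longrightarrow> Poly_Mapping.lookup e v = 0"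
  shows "stretch_laurent v m L = L"
proof -
  have "stretch_laurent v m L
      = (\<Sum>e\<in>Poly_Mapping.keys L. Poly_Mapping.single e (Poly_Mapping.lookup L e))"
    unfolding stretch_laurent_def using assms
    by (intro sum.cong arg_cong2[of _ _ _ _ Poly_Mapping.single]) (auto intro: stretch_exp_free)
  then show ?thesis using laurent_eq_sum_single[of "Poly_Mapping.keys L" L] by simp
qed

lemma Z_y_single:
  "Z_y n (Poly_Mapping.single e c)
    = (if \<forall>v<n. Poly_Mapping.lookup e v \<in> \<int> then Poly_Mapping.single e c else 0)"
  by (rule poly_mapping_eqI) (auto simp: lookup_Z_y lookup_single when_def)

text \<open>\<open>n \<le> v\<close> says that the stretched variable is not a y-variable, so the
  integrality test of \<open>Z_y\<close> does not see the substitution.\<close>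

lemma Z_y_stretch_laurent:
  assumes "n \<le> v"
  shows "Z_y n (stretch_laurent v m L) = stretch_laurent v m (Z_y n L)"
proof (induction L rule: laurent_induct)
  case (single e c)
  have "(\<forall>w<n. Poly_Mapping.lookup (stretch_exp v m e) w \<in> \<int>) \<longleftrightarrow> (\<forall>w<n. Poly_Mapping.lookup e w \<in> \<int>)"
    using assms by (auto simp: lookup_stretch_exp)
  then show ?case unfolding stretch_laurent_single Z_y_single by auto
qed (simp add: stretch_laurent_add Z_y_add)

lemma stretch_stretch: "stretch v m (stretch v m' R) = stretch v (m * m') R"
  by (simp add: stretch_def stretch_laurent_stretch_laurent stretch_exp_stretch_exp)

lemma stretch_Z_frat:
  assumes "n \<le> v"
  shows "stretch v m (Z_frat n p R) = Z_frat n p (stretch v m R)"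
  using assms
  by (simp add: stretch_def Z_frat_def stretch_exp_scale Z_y_stretch_laurent[symmetric]
      stretch_laurent_mult stretch_laurent_prod stretch_laurent_sum stretch_laurent_power)


section \<open>Substitution of powers in rational functions\<close>

definition stretch_fract :: "nat \<Rightarrow> nat \<Rightarrow> 'k::field flaurent fract \<Rightarrow> 'k flaurent fract" where
  "stretch_fract v m F =
    (THE G. \<exists>a d. d \<noteq> 0 \<and> F = Fract a d \<and> G = Fract (stretch_laurent v m a) (stretch_laurent v m d))"

text \<open>Independence of the presentation follows by applying the multiplicative map to
  \<open>a * e = b * d\<close>; its injectivity keeps denominators nonzero.\<close>

lemma stretch_fract_Fract:
  assumes m: "0 < m" and "d \<noteq> 0"
  shows "stretch_fract v m (Fract a d) = Fract (stretch_laurent v m a) (stretch_laurent v m d)"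
  unfolding stretch_fract_def
proof (rule the_equality)
  fix G assume "\<exists>b e. e \<noteq> 0 \<and> Fract a d = Fract b e
      \<and> G = Fract (stretch_laurent v m b) (stretch_laurent v m e)"
  then obtain b e where "e \<noteq> 0" "a * e = b * d"
      and G: "G = Fract (stretch_laurent v m b) (stretch_laurent v m e)"
    using assms by (auto simp: eq_fract)
  then have "stretch_laurent v m a * stretch_laurent v m e
      = stretch_laurent v m b * stretch_laurent v m d"
    by (simp flip: stretch_laurent_mult)
  then show "G = Fract (stretch_laurent v m a) (stretch_laurent v m d)"
    using \<open>e \<noteq> 0\<close> assms by (simp add: G eq_fract stretch_laurent_eq_0_iff)
qed (use assms in blast)

context
  fixes v m :: nat
  assumes m: "0 < m"
begin

lemma stretch_fract_of_laurent: "stretch_fract v m (of_laurent L) = of_laurent (stretch_laurent v m L)"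
  by (simp add: of_laurent_def stretch_fract_Fract[OF m])

lemma stretch_fract_zero: "stretch_fract v m 0 = 0"
  by (simp add: Zero_fract_def stretch_fract_Fract[OF m])

lemma stretch_fract_one: "stretch_fract v m 1 = 1"
  by (simp add: One_fract_def stretch_fract_Fract[OF m])

lemma stretch_fract_add: "stretch_fract v m (F + G) = stretch_fract v m F + stretch_fract v m G"
  by (cases F, cases G)
    (simp add: stretch_fract_Fract[OF m] stretch_laurent_add stretch_laurent_mult
      stretch_laurent_eq_0_iff[OF m])

lemma stretch_fract_mult: "stretch_fract v m (F * G) = stretch_fract v m F * stretch_fract v m G"
  by (cases F, cases G) (simp add: stretch_fract_Fract[OF m] stretch_laurent_mult)

lemma stretch_fract_diff: "stretch_fract v m (F - G) = stretch_fract v m F - stretch_fract v m G"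
  using stretch_fract_add[of "F - G" G] by simp

lemma stretch_fract_divide: "stretch_fract v m (F / G) = stretch_fract v m F / stretch_fract v m G"
proof (cases "G = 0")
  case False
  have nz: "stretch_fract v m G \<noteq> 0"
  proof
    assume "stretch_fract v m G = 0"
    then have "stretch_fract v m (G * inverse G) = 0" by (simp add: stretch_fract_mult)
    then show False using False by (simp add: stretch_fract_one)
  qed
  have "stretch_fract v m (F / G) * stretch_fract v m G = stretch_fract v m F"
    using False by (simp flip: stretch_fract_mult)
  then show ?thesis using nz by (simp add: eq_divide_eq)
qed (simp add: stretch_fract_zero)

lemma stretch_fract_power: "stretch_fract v m (F ^ d) = stretch_fract v m F ^ d"
  by (induction d) (auto simp: stretch_fract_one stretch_fract_mult)

lemma stretch_fract_sum: "stretch_fract v m (\<Sum>l\<in>S. f l) = (\<Sum>l\<in>S. stretch_fract v m (f l))"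
  by (induction S rule: infinite_finite_induct) (auto simp: stretch_fract_zero stretch_fract_add)

lemma stretch_fract_frat_val:
  assumes "proper_frat R"
  shows "stretch_fract v m (frat_val R) = frat_val (stretch v m R)"
proof -
  have "(\<Prod>j\<in>dens R. 1 - xpow (dexp R j)) \<noteq> (0 :: 'a flaurent)"
    using assms by (auto simp: proper_frat_def)
  then show ?thesis
    by (simp add: frat_val_def stretch_fract_Fract[OF m] stretch_def stretch_laurent_prod
        stretch_laurent_diff)
qed

end


section \<open>Rings of fractions of Laurent polynomials\<close>

definition laurent_over :: "exponent set \<Rightarrow> 'k::field flaurent set" where
  "laurent_over W = {L. Poly_Mapping.keys L \<subseteq> W}"

definition exp_submonoid :: "exponent set \<Rightarrow> bool" where
  "exp_submonoid W \<longleftrightarrow> 0 \<in> W \<and> (\<forall>e\<in>W. \<forall>f\<in>W. e + f \<in> W)"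

lemma exp_submonoid_free: "exp_submonoid {e. Poly_Mapping.lookup e v = 0}"
  by (simp add: exp_submonoid_def lookup_add)

lemma exp_submonoid_integral: "exp_submonoid {e. Poly_Mapping.lookup e v \<in> \<int>}"
  by (simp add: exp_submonoid_def lookup_add)

lemma exp_submonoid_UNIV: "exp_submonoid UNIV"
  by (simp add: exp_submonoid_def)

lemma subring_laurent_over:
  assumes "exp_submonoid W"
  shows "is_subring (laurent_over W :: 'k::field flaurent set)"
proof (rule is_subringI)
  fix K L :: "'k flaurent" assume KL: "K \<in> laurent_over W" "L \<in> laurent_over W"
  show "K + L \<in> laurent_over W"
    using KL Poly_Mapping.keys_add[of K L] by (auto simp: laurent_over_def)
  show "K * L \<in> laurent_over W"
  proof -
    have "e \<in> W" if e: "e \<in> Poly_Mapping.keys (K * L)" for e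
    proof -
      from e obtain a c where "e = a + c" "a \<in> Poly_Mapping.keys K" "c \<in> Poly_Mapping.keys L"
        using keys_mult by blast
      then show ?thesis using KL assms by (auto simp: laurent_over_def exp_submonoid_def)
    qed
    then show ?thesis by (auto simp: laurent_over_def)
  qed
qed (use assms in \<open>auto simp: laurent_over_def exp_submonoid_def\<close>)

lemma xpow_in_laurent_over: "e \<in> W \<Longrightarrow> xpow e \<in> laurent_over W"
  by (simp add: laurent_over_def xpow_def)

text \<open>Lists allow repeated factors and make closure under products a matter of
  appending.\<close>

definition binomial_products :: "exponent set \<Rightarrow> 'k::field flaurent set" where
  "binomial_products W = {(\<Prod>e\<leftarrow>es. 1 - xpow e) | es. set es \<subseteq> W - {0}}"

lemma binomial_products_mult:
  assumes "c \<in> binomial_products W" "d \<in> binomial_products W"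
  shows "c * d \<in> binomial_products W"
proof -
  from assms obtain es fs where "set es \<subseteq> W - {0}" "c = (\<Prod>e\<leftarrow>es. 1 - xpow e)"
    "set fs \<subseteq> W - {0}" "d = (\<Prod>e\<leftarrow>fs. 1 - xpow e)" unfolding binomial_products_def by blast
  then show ?thesis unfolding binomial_products_def
    by (intro CollectI exI[of _ "es @ fs"]) simp
qed

lemma one_in_binomial_products: "1 \<in> binomial_products W"
  unfolding binomial_products_def by (intro CollectI exI[of _ "[]"]) simp

lemma binomial_in_binomial_products:
  "e \<in> W \<Longrightarrow> e \<noteq> 0 \<Longrightarrow> 1 - xpow e \<in> binomial_products W"
  unfolding binomial_products_def by (intro CollectI exI[of _ "[e]"]) simp

lemma zero_notin_binomial_products: "(0 :: 'k::field flaurent) \<notin> binomial_products W"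
  by (auto simp: binomial_products_def prod_list_zero_iff)

lemma binomial_products_subset:
  assumes "exp_submonoid W"
  shows "(binomial_products W :: 'k::field flaurent set) \<subseteq> laurent_over W"
proof -
  note L = subring_laurent_over[OF assms, where 'k = 'k]
  have "(\<Prod>e\<leftarrow>es. 1 - xpow e :: 'k flaurent) \<in> laurent_over W" if "set es \<subseteq> W - {0}" for es
    using that by (induction es)
      (auto intro!: subring_mult[OF L] subring_diff[OF L] subring_one[OF L] xpow_in_laurent_over)
  then show ?thesis by (auto simp: binomial_products_def)
qed

text \<open>Two instances matter: exponents without \<lambda> give the coefficients of the
  decomposition, and \<open>W = UNIV\<close> gives the fractions on which \<open>Z_fract\<close> is
  determined.\<close>

definition binomial_fractions :: "exponent set \<Rightarrow> 'k::field flaurent fract set" where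
  "binomial_fractions W = fractions (laurent_over W) (binomial_products W)"

lemma subring_binomial_fractions:
  "exp_submonoid W \<Longrightarrow> is_subring (binomial_fractions W)"
  unfolding binomial_fractions_def
  by (intro subring_fractions subring_laurent_over binomial_products_subset
      one_in_binomial_products zero_notin_binomial_products binomial_products_mult)

lemma binomial_fractions_mono: "W \<subseteq> V \<Longrightarrow> binomial_fractions W \<subseteq> binomial_fractions V"
  unfolding binomial_fractions_def fractions_def laurent_over_def binomial_products_def by blast

lemma of_laurent_in_binomial_fractions:
  "L \<in> laurent_over W \<Longrightarrow> of_laurent L \<in> binomial_fractions W"
  unfolding binomial_fractions_def of_laurent_def
  by (intro Fract_in_fractions one_in_binomial_products)

section \<open>Laurent polynomials inside the field of fractions\<close>

lemma of_laurent_0 [simp]: "of_laurent 0 = 0"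
  and of_laurent_1 [simp]: "of_laurent 1 = 1"
  and of_laurent_add: "of_laurent (K + L) = of_laurent K + of_laurent L"
  and of_laurent_diff: "of_laurent (K - L) = of_laurent K - of_laurent L"
  and of_laurent_mult: "of_laurent (K * L) = of_laurent K * of_laurent L"
  by (simp_all add: of_laurent_def Zero_fract_def One_fract_def)

lemma of_laurent_power: "of_laurent (L ^ d) = of_laurent L ^ d"
  by (induction d) (auto simp: of_laurent_mult)

lemma of_laurent_sum: "of_laurent (\<Sum>l\<in>S. f l) = (\<Sum>l\<in>S. of_laurent (f l))"
  by (induction S rule: infinite_finite_induct) (auto simp: of_laurent_add)

lemma of_laurent_prod: "of_laurent (\<Prod>l\<in>S. f l) = (\<Prod>l\<in>S. of_laurent (f l))"
  by (induction S rule: infinite_finite_induct) (auto simp: of_laurent_mult)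

lemma of_laurent_eq_iff [simp]: "of_laurent K = of_laurent L \<longleftrightarrow> K = L"
  by (simp add: of_laurent_def eq_fract)

lemma of_laurent_eq_0_iff [simp]: "of_laurent L = 0 \<longleftrightarrow> L = 0"
  using of_laurent_eq_iff[of L 0] by simp

lemma Fract_eq_of_laurent: "Fract a d = of_laurent a / of_laurent d"
  by (simp add: of_laurent_def)

abbreviation xf :: "exponent \<Rightarrow> 'k::field flaurent fract" where
  "xf e \<equiv> of_laurent (xpow e)"

lemma xf_add: "xf (e + f) = xf e * xf f"
  by (simp add: xpow_def mult_single flip: of_laurent_mult)

lemma xf_0 [simp]: "xf 0 = 1"
  by (simp add: xpow_def)

lemma xf_eq_1_iff: "xf e = 1 \<longleftrightarrow> e = 0"
  unfolding of_laurent_1[symmetric] of_laurent_eq_iff by simp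

lemma xf_uminus: "xf (- e) = inverse (xf e)"
  by (rule inverse_unique[symmetric]) (simp flip: xf_add)

lemma xpow_nonzero [simp]: "xpow e \<noteq> 0"
proof
  assume "xpow e = (0 :: 'a flaurent)"
  then have "Poly_Mapping.lookup (xpow e) e = (0 :: 'a)" by simp
  then show False by (simp add: xpow_def)
qed

lemma xf_scale: "xf (scale (of_nat p) e) = xf e ^ p"
  by (simp add: xpow_scale of_laurent_power)

lemma inverse_binomial_in_binomial_fractions:
  assumes "exp_submonoid W" "e \<in> W" "e \<noteq> 0"
  shows "(inverse (1 - xf e) :: 'k::field flaurent fract) \<in> binomial_fractions W"
proof -
  have "(inverse (1 - xf e) :: 'k flaurent fract) = Fract 1 (1 - xpow e)"
    by (simp add: Fract_eq_of_laurent of_laurent_diff inverse_eq_divide)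
  then show ?thesis
    unfolding binomial_fractions_def using assms
    by (simp add: Fract_in_fractions binomial_in_binomial_products
        subring_one[OF subring_laurent_over])
qed

lemma xf_in_binomial_fractions: "e \<in> W \<Longrightarrow> xf e \<in> binomial_fractions W"
  by (intro of_laurent_in_binomial_fractions xpow_in_laurent_over)

lemma frat_val_eq: "frat_val R = of_laurent (numer R) * (\<Prod>j\<in>dens R. inverse (1 - xf (dexp R j)))"
  by (simp add: frat_val_def Fract_eq_of_laurent of_laurent_prod of_laurent_diff
      divide_inverse prod_inversef flip: prod_inversef)

text \<open>Connects the ring with \<open>Z_fract\<close>, whose definition speaks of records. The
  positions in the list serve as indices, so equal binomials remain separate factors.\<close>

lemma binomial_fractions_frat_val:
  assumes "F \<in> binomial_fractions W"
  obtains R where "proper_frat R" "frat_val R = F"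
    "Poly_Mapping.keys (numer R) \<subseteq> W" "dexp R ` dens R \<subseteq> W"
proof -
  from assms obtain a es where *: "a \<in> laurent_over W" "set es \<subseteq> W - {0}"
    "F = Fract a (\<Prod>e\<leftarrow>es. 1 - xpow e)"
    unfolding binomial_fractions_def fractions_def binomial_products_def by blast
  define R where "R = \<lparr>numer = a, dens = {..<length es}, dexp = (!) es\<rparr>"
  have "(\<Prod>e\<leftarrow>es. 1 - xpow e) = (\<Prod>j<length es. 1 - xpow (es ! j) :: 'a flaurent)"
    by (simp add: prod.list_conv_set_nth atLeast0LessThan)
  then have "frat_val R = F" by (simp add: R_def frat_val_def *)
  moreover have "proper_frat R" "dexp R ` dens R \<subseteq> W"
    using subsetD[OF *(2) nth_mem] by (auto simp: R_def proper_frat_def)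
  ultimately show ?thesis
    using *(1) by (intro that) (auto simp: R_def laurent_over_def)
qed

text \<open>Arbitrary nonzero \<lambda>-free denominators are allowed here, so this ring contains
  the binomial fractions in the \<lambda>-free exponents. Uniqueness is proved over it.\<close>

lemma free_of_iff:
  "free_of v F \<longleftrightarrow> F \<in> fractions (laurent_over {e. Poly_Mapping.lookup e v = 0})
    (laurent_over {e. Poly_Mapping.lookup e v = 0} - {0})"
  unfolding free_of_def fractions_def laurent_over_def by auto

lemma subring_free_of: "is_subring {F. free_of v F}"
proof -
  note L = subring_laurent_over[OF exp_submonoid_free[of v]]
  show ?thesis
    unfolding free_of_iff Collect_mem_eq
    by (intro subring_fractions L) (auto intro: subring_one[OF L] subring_mult[OF L])
qed

lemma free_of_binomial_fractions:
  "binomial_fractions {e. Poly_Mapping.lookup e v = 0} \<subseteq> {F. free_of v F}"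
  unfolding free_of_iff binomial_fractions_def fractions_def
  using binomial_products_subset[OF exp_submonoid_free[of v]] zero_notin_binomial_products
  by blast

lemma stretch_fract_free:
  assumes m: "0 < m" and "free_of v F"
  shows "stretch_fract v m F = F"
proof -
  from assms(2) obtain a d where "d \<noteq> 0" "F = Fract a d"
    "\<forall>e \<in> Poly_Mapping.keys a \<union> Poly_Mapping.keys d. Poly_Mapping.lookup e v = 0"
    unfolding free_of_def by blast
  then show ?thesis
    by (simp add: stretch_fract_Fract[OF m] stretch_laurent_free)
qed


section \<open>The distinguished variable\<close>

abbreviation free_exps :: "nat \<Rightarrow> exponent set" where
  "free_exps v \<equiv> {e. Poly_Mapping.lookup e v = 0}"

abbreviation lam :: "nat \<Rightarrow> 'k::field flaurent fract" where
  "lam v \<equiv> xf (Poly_Mapping.single v 1)"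

abbreviation lam_polys :: "nat \<Rightarrow> 'k::field flaurent fract set" where
  "lam_polys v \<equiv> values_at (lam v) (binomial_fractions (free_exps v))"

lemma subring_free_fractions: "is_subring (binomial_fractions (free_exps v))"
  by (intro subring_binomial_fractions exp_submonoid_free)

lemma subring_lam_polys: "is_subring (lam_polys v)"
  by (intro subring_values_at subring_free_fractions)

definition free_part :: "nat \<Rightarrow> exponent \<Rightarrow> exponent" where
  "free_part v e = Poly_Mapping.update v 0 e"

lemma lookup_free_part:
  "Poly_Mapping.lookup (free_part v e) w = (if w = v then 0 else Poly_Mapping.lookup e w)"
  by (simp add: free_part_def lookup_update)

lemma exponent_split:
  assumes "Poly_Mapping.lookup e v = of_nat a"
  shows "e = free_part v e + scale (of_nat a) (Poly_Mapping.single v 1)"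
  by (rule poly_mapping_eqI) (auto simp: lookup_add lookup_free_part lookup_single when_def assms)

lemma xf_split:
  assumes "Poly_Mapping.lookup e v = of_nat a"
  shows "xf e = xf (free_part v e) * lam v ^ a"
  by (subst exponent_split[OF assms]) (simp add: xf_add xf_scale)

text \<open>A monomial read as a polynomial in \<lambda>. The rounding is exact only for natural
  \<lambda>-exponents, hence the assumption \<open>of_nat a\<close> in the facts about its value and
  degree.\<close>

definition xf_poly :: "nat \<Rightarrow> exponent \<Rightarrow> 'k::field flaurent fract poly" where
  "xf_poly v e = monom (xf (free_part v e)) (nat \<lfloor>Poly_Mapping.lookup e v\<rfloor>)"

lemma poly_xf_poly:
  assumes "Poly_Mapping.lookup e v = of_nat a"
  shows "poly (xf_poly v e) (lam v) = xf e"
  by (simp add: xf_poly_def poly_monom assms xf_split[OF assms])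

lemma free_part_in [simp]: "free_part v e \<in> free_exps v"
  by (simp add: lookup_free_part)

lemma xf_poly_in_polys: "xf_poly v e \<in> polys (binomial_fractions (free_exps v))"
  unfolding xf_poly_def
  by (intro monom_in_polys subring_free_fractions xf_in_binomial_fractions free_part_in)

lemma degree_one_minus_xf_poly:
  assumes "Poly_Mapping.lookup e v = of_nat a" "0 < a"
  defines "f \<equiv> 1 - xf_poly v e :: 'k::field flaurent fract poly"
  shows "degree f = a" "lead_coeff f = - xf (free_part v e)"
proof -
  have eq: "f = 1 + - monom (xf (free_part v e)) a"
    by (simp add: f_def xf_poly_def assms)
  show *: "degree f = a"
    unfolding eq using assms(2) by (subst degree_add_eq_right) (simp_all add: degree_monom_eq)
  show "lead_coeff f = - xf (free_part v e)"
    unfolding * using assms(2) by (simp add: eq)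
qed

lemma xf_in_lam_polys:
  assumes "Poly_Mapping.lookup e v = of_nat a"
  shows "xf e \<in> lam_polys v"
  unfolding poly_xf_poly[OF assms, symmetric] by (intro poly_in_values_at xf_poly_in_polys)

lemma lam_in_lam_polys: "lam v \<in> lam_polys v"
  by (intro point_in_values_at subring_free_fractions)

text \<open>Writing the monomial as \<open>u * \<lambda>^a\<close> with \<open>a > 0\<close>, the
  identity \<open>(u * \<lambda>^(a - 1)) * \<lambda> + (1 - u * \<lambda>^a) = 1\<close> settles
  the first power of \<lambda>, and comaximality passes to powers.\<close>

lemma comaximal_lam_binomial:
  assumes e: "Poly_Mapping.lookup e v = of_nat a" "0 < a"
  shows "comaximal (lam_polys v) (lam v ^ t) (1 - xf e)"
proof -
  note O = subring_lam_polys[of v]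
  have "(xf (free_part v e) * lam v ^ (a - 1)) * lam v + 1 * (1 - xf e) = 1"
    using e(2) by (cases a) (simp_all add: xf_split[OF e(1)] mult_ac)
  then have "comaximal (lam_polys v) (lam v) (1 - xf e)"
    unfolding comaximal_def
    by (intro bexI[of _ "xf (free_part v e) * lam v ^ (a - 1)"] bexI[of _ 1])
      (auto intro!: subring_intros[OF O] lam_in_lam_polys xf_in_lam_polys[of _ _ 0]
        simp: lookup_free_part)
  then show ?thesis
    by (intro comaximal_sym[OF comaximal_power[OF O _ _ comaximal_sym]]
        subring_diff[OF O] subring_one[OF O] xf_in_lam_polys[OF e(1)] lam_in_lam_polys)
qed

text \<open>
  Put \<open>x = xf e\<close>, \<open>y = xf f\<close> and let \<open>\<epsilon>\<close> be the \<open>\<lambda>\<close>-free monomial \<open>x^b / y^a\<close>. Bezout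
  coefficients for \<open>1 - x\<close> and \<open>1 - y\<close> come from \<open>1 - \<epsilon> = (1 - x^b) - \<epsilon> (1 - y^a)\<close>.
\<close>

lemma comaximal_binomials:
  assumes e: "Poly_Mapping.lookup e v = of_nat a" and f: "Poly_Mapping.lookup f v = of_nat b"
    and ne: "scale (of_nat b) e \<noteq> scale (of_nat a) f"
  shows "comaximal (lam_polys v) (1 - xf e) (1 - xf f :: 'k::field flaurent fract)"
proof -
  note O = subring_lam_polys[of v, where 'a = 'k]
  define h where "h = scale (of_nat b) e - scale (of_nat a) f"
  define \<epsilon> where "\<epsilon> = (xf h :: 'k flaurent fract)"
  \<comment> \<open>Both multiples have \<lambda>-exponent \<open>a * b\<close>, so it cancels in
    \<open>h\<close>, and \<open>ne\<close> makes \<open>h\<close> nonzero. Hence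
    \<open>1 - \<epsilon>\<close> is one of the binomials that the coefficient ring inverts.\<close>
  have h: "h \<in> free_exps v" "h \<noteq> 0"
    using ne by (auto simp: h_def lookup_minus e f)
  have \<epsilon>: "\<epsilon> \<in> lam_polys v" "inverse (1 - \<epsilon>) \<in> lam_polys v" "1 - \<epsilon> \<noteq> 0"
    using h xf_eq_1_iff[of h, where 'a = 'k] unfolding \<epsilon>_def
    by (auto intro!: const_in_values_at subring_free_fractions xf_in_binomial_fractions
        inverse_binomial_in_binomial_fractions exp_submonoid_free)
  have "scale (of_nat b) e = h + scale (of_nat a) f" by (simp add: h_def)
  then have xy: "(xf e :: 'k flaurent fract) ^ b = \<epsilon> * xf f ^ a"
    unfolding \<epsilon>_def by (metis xf_scale xf_add)
  define \<alpha> where "\<alpha> = (\<Sum>i<b. (xf e :: 'k flaurent fract) ^ i)"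
  define \<beta> where "\<beta> = (\<Sum>i<a. (xf f :: 'k flaurent fract) ^ i)"
  have \<alpha>\<beta>: "\<alpha> \<in> lam_polys v" "\<beta> \<in> lam_polys v"
    unfolding \<alpha>_def \<beta>_def
    by (intro subring_sum[OF O] subring_power[OF O] xf_in_lam_polys[OF e] xf_in_lam_polys[OF f])+
  have "1 - \<epsilon> = (1 - xf e ^ b) - \<epsilon> * (1 - xf f ^ a)"
    by (simp add: xy algebra_simps)
  also have "\<dots> = \<alpha> * (1 - xf e) + (- \<epsilon> * \<beta>) * (1 - xf f)"
    unfolding one_diff_power_eq \<alpha>_def \<beta>_def by (simp add: algebra_simps)
  finally have "inverse (1 - \<epsilon>) * (1 - \<epsilon>)
      = inverse (1 - \<epsilon>) * (\<alpha> * (1 - xf e) + (- \<epsilon> * \<beta>) * (1 - xf f))"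
    by (rule arg_cong)
  then have "1 = (inverse (1 - \<epsilon>) * \<alpha>) * (1 - xf e) + (inverse (1 - \<epsilon>) * (- \<epsilon> * \<beta>)) * (1 - xf f)"
    by (simp only: left_inverse[OF \<epsilon>(3)] distrib_left mult.assoc)
  then show ?thesis
    unfolding comaximal_def using \<epsilon> \<alpha>\<beta>
    by (intro bexI[of _ "inverse (1 - \<epsilon>) * \<alpha>"] bexI[of _ "inverse (1 - \<epsilon>) * (- \<epsilon> * \<beta>)"])
      (auto intro!: subring_intros[OF O])
qed

section \<open>Transcendence of \<lambda> over the \<lambda>-free fractions\<close>

lemma lookup_mult_xpow: "Poly_Mapping.lookup (L * xpow g) e = Poly_Mapping.lookup L (e - g)"
  by (induction L rule: laurent_induct)
    (auto simp: xpow_def mult_single lookup_single lookup_add distrib_right when_def eq_diff_eq)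

text \<open>Different powers of \<lambda> with \<lambda>-free Laurent coefficients have no exponent
  vector in common, so nothing can cancel. Equality of values at \<open>lam v\<close> thereby
  becomes equality of polynomials, to which degree arguments apply.\<close>

lemma lam_transcendental:
  fixes p :: "'k::field flaurent fract poly"
  assumes p: "p \<in> polys {F. free_of v F}" and 0: "poly p (lam v) = 0"
  shows "p = 0"
proof (rule ccontr)
  assume "p \<noteq> 0"
  note L = subring_laurent_over[OF exp_submonoid_free[of v], where 'k = 'k]
  have "\<forall>d. \<exists>a b. coeff p d = Fract a b \<and> a \<in> laurent_over (free_exps v)
      \<and> b \<in> laurent_over (free_exps v) \<and> b \<noteq> 0"
    using p unfolding polys_def free_of_iff fractions_def by auto
  then obtain a b where ab: "\<And>d. coeff p d = Fract (a d) (b d)" "\<And>d. b d \<noteq> 0"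
    "\<And>d. a d \<in> laurent_over (free_exps v)" "\<And>d. b d \<in> laurent_over (free_exps v)"
    by metis
  \<comment> \<open>Coefficient \<open>d\<close> after multiplication by the common denominator
    \<open>B\<close>, written without division.\<close>
  define c where "c d = a d * (\<Prod>i\<in>{..degree p} - {d}. b i)" for d
  define B where "B = (\<Prod>i\<le>degree p. b i)"
  have c: "c d \<in> laurent_over (free_exps v)" for d
    unfolding c_def by (intro subring_mult[OF L] subring_prod[OF L] ab)
  have Bc: "of_laurent B * coeff p d = of_laurent (c d)" if "d \<le> degree p" for d
  proof -
    have "B = b d * (\<Prod>i\<in>{..degree p} - {d}. b i)"
      unfolding B_def using that by (intro prod.remove) auto
    then show ?thesis
      using ab(2)[of d]
      by (simp add: ab(1) c_def Fract_eq_of_laurent of_laurent_mult field_simps)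
  qed
  have "0 = of_laurent B * poly p (lam v)" by (simp add: 0)
  also have "\<dots> = (\<Sum>d\<le>degree p. (of_laurent B * coeff p d) * lam v ^ d)"
    by (simp add: poly_altdef sum_distrib_left mult.assoc)
  also have "\<dots> = (\<Sum>d\<le>degree p. of_laurent (c d * xpow (scale (of_nat d) (Poly_Mapping.single v 1))))"
    by (intro sum.cong refl) (simp add: Bc of_laurent_mult xf_scale)
  also have "\<dots> = of_laurent (\<Sum>d\<le>degree p. c d * xpow (scale (of_nat d) (Poly_Mapping.single v 1)))"
    by (simp add: of_laurent_sum)
  finally have "of_laurent (\<Sum>d\<le>degree p. c d * xpow (scale (of_nat d) (Poly_Mapping.single v 1))) = 0"
    by (rule sym)
  then have sum0: "(\<Sum>d\<le>degree p. c d * xpow (scale (of_nat d) (Poly_Mapping.single v 1))) = 0"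
    unfolding of_laurent_eq_0_iff .
  let ?n = "degree p"
  have "Poly_Mapping.lookup (c ?n) e = 0" if e: "e \<in> free_exps v" for e
  proof -
    \<comment> \<open>The \<lambda>-exponent of \<open>f\<close> is \<open>?n\<close>, while the
      summand with index \<open>d\<close> only has terms of \<lambda>-exponent \<open>d\<close>. At
      \<open>f\<close> the sum reduces to its top summand.\<close>
    define f where "f = e + scale (of_nat ?n) (Poly_Mapping.single v 1)"
    have z: "Poly_Mapping.lookup (c d) (f - scale (of_nat d) (Poly_Mapping.single v 1)) = 0" if "d < ?n" for d
    proof -
      have "f - scale (of_nat d) (Poly_Mapping.single v 1) \<notin> free_exps v"
        using e that by (simp add: f_def lookup_minus lookup_add)
      then show ?thesis using c[of d] by (auto simp: laurent_over_def in_keys_iff)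
    qed
    have "0 = Poly_Mapping.lookup (\<Sum>d\<le>?n. c d * xpow (scale (of_nat d) (Poly_Mapping.single v 1))) f"
      by (simp add: sum0)
    also have "\<dots> = (\<Sum>d\<le>?n. Poly_Mapping.lookup (c d) (f - scale (of_nat d) (Poly_Mapping.single v 1)))"
      by (simp add: lookup_sum lookup_mult_xpow)
    also have "\<dots> = (\<Sum>d\<in>{?n}. Poly_Mapping.lookup (c d) (f - scale (of_nat d) (Poly_Mapping.single v 1)))"
      using z by (intro sum.mono_neutral_right) (auto simp: le_less)
    also have "\<dots> = Poly_Mapping.lookup (c ?n) e" by (simp add: f_def)
    finally show ?thesis by simp
  qed
  moreover have "Poly_Mapping.lookup (c ?n) e = 0" if "e \<notin> free_exps v" for e
    using c[of ?n] that by (auto simp: laurent_over_def in_keys_iff)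
  ultimately have "c ?n = 0" by (intro poly_mapping_eqI) (metis lookup_zero)
  moreover have "B \<noteq> 0" using ab(2) by (simp add: B_def)
  ultimately have "coeff p ?n = 0"
    using Bc[of ?n] by simp
  with \<open>p \<noteq> 0\<close> show False by simp
qed


section \<open>Existence of the partial fraction decomposition\<close>

text \<open>Proportional nonzero exponent vectors belong to powers of one fractional monomial
  \<open>z\<close>, and then \<open>1 - z\<close> divides both factors. Stated through arbitrary
  nonzero multipliers, the condition is insensitive to scaling and to the sign change of
  \<open>pos_exp\<close>.\<close>

definition coprime_dens :: "'k::field frat \<Rightarrow> bool" where
  "coprime_dens R \<longleftrightarrow> (\<forall>l\<in>dens R. \<forall>l'\<in>dens R. l \<noteq> l' \<longrightarrow>
    (\<forall>a b. a \<noteq> 0 \<longrightarrow> b \<noteq> 0 \<longrightarrow> scale a (dexp R l) \<noteq> scale b (dexp R l')))"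

text \<open>The \<lambda>-degree of the factor after a negative exponent has been inverted, hence
  the absolute value. The rounding is exact under \<open>integral_dens\<close>.\<close>

definition lam_deg :: "nat \<Rightarrow> 'k::field frat \<Rightarrow> nat \<Rightarrow> nat" where
  "lam_deg v R l = nat \<bar>\<lfloor>Poly_Mapping.lookup (dexp R l) v\<rfloor>\<bar>"

definition lam_dens :: "nat \<Rightarrow> 'k::field frat \<Rightarrow> nat set" where
  "lam_dens v R = {l \<in> dens R. Poly_Mapping.lookup (dexp R l) v \<noteq> 0}"

definition integral_dens :: "nat \<Rightarrow> 'k::field frat \<Rightarrow> bool" where
  "integral_dens v R \<longleftrightarrow> (\<forall>l\<in>dens R. Poly_Mapping.lookup (dexp R l) v \<in> \<int>)"

lemma lookup_pos_exp_lam_deg: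
  assumes "integral_dens v R" "l \<in> dens R"
  shows "Poly_Mapping.lookup (pos_exp v (dexp R l)) v = of_nat (lam_deg v R l)"
  using assms by (auto simp: integral_dens_def lookup_pos_exp lam_deg_def elim!: Ints_cases)

lemma lam_deg_pos:
  assumes "integral_dens v R" "l \<in> lam_dens v R"
  shows "0 < lam_deg v R l"
  using assms by (auto simp: integral_dens_def lam_deg_def lam_dens_def elim!: Ints_cases)

lemma partial_fractions_iff:
  assumes "integral_dens v R"
  shows "partial_fractions v R P q t A \<longleftrightarrow>
    P \<in> polys {F. free_of v F} \<and> q \<in> polys {F. free_of v F} \<and> degree q < t \<and>
    (\<forall>l\<in>lam_dens v R. A l \<in> polys {F. free_of v F} \<and> degree (A l) < lam_deg v R l) \<and>
    frat_val R = poly P (lam v) + poly q (lam v) / lam v ^ t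
      + (\<Sum>l\<in>lam_dens v R. poly (A l) (lam v) / (1 - xf (pos_exp v (dexp R l))))"
proof -
  have "{l \<in> dens R. 0 < Poly_Mapping.lookup (pos_exp v (dexp R l)) v} = lam_dens v R"
    by (auto simp: lam_dens_def lookup_pos_exp)
  moreover have "of_nat (degree (A l)) < Poly_Mapping.lookup (pos_exp v (dexp R l)) v
      \<longleftrightarrow> degree (A l) < lam_deg v R l" if "l \<in> lam_dens v R" for l
    using lookup_pos_exp_lam_deg[OF assms, of l] that by (simp add: lam_dens_def)
  ultimately show ?thesis
    unfolding partial_fractions_def Let_def polys_def by auto
qed

text \<open>The cross-multiplied exponents in \<open>comaximal_binomials\<close> are nonzero
  multiples of the original ones, since the \<lambda>-degrees are positive and the signs are
  nonzero; \<open>coprime_dens\<close> therefore separates them.\<close>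

lemma comaximal_dens:
  assumes R: "integral_dens v R" "coprime_dens R" and l: "l \<in> lam_dens v R" "l' \<in> lam_dens v R" "l \<noteq> l'"
  shows "comaximal (lam_polys v) (1 - xf (pos_exp v (dexp R l))) (1 - xf (pos_exp v (dexp R l')))"
proof (rule comaximal_binomials[OF lookup_pos_exp_lam_deg[OF R(1)] lookup_pos_exp_lam_deg[OF R(1)]])
  obtain s s' where s: "s \<noteq> 0" "pos_exp v (dexp R l) = scale s (dexp R l)"
      and s': "s' \<noteq> 0" "pos_exp v (dexp R l') = scale s' (dexp R l')"
    using pos_exp_eq_scale by metis
  show "scale (of_nat (lam_deg v R l')) (pos_exp v (dexp R l))
      \<noteq> scale (of_nat (lam_deg v R l)) (pos_exp v (dexp R l'))"
    using R(2) l lam_deg_pos[OF R(1) l(1)] lam_deg_pos[OF R(1) l(2)] s(1) s'(1)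
    unfolding s(2) s'(2) scale_scale coprime_dens_def lam_dens_def by auto
qed (use l in \<open>auto simp: lam_dens_def\<close>)

lemma xf_localized:
  assumes "Poly_Mapping.lookup e v \<in> \<int>"
  shows "\<exists>d. lam v ^ d * xf e \<in> lam_polys v"
proof -
  from assms obtain k where k: "Poly_Mapping.lookup e v = of_int k" by (auto elim: Ints_cases)
  \<comment> \<open>The sum of k and its absolute value is nonnegative for either sign of k, so this
    power of \<lambda> always suffices.\<close>
  define f where "f = scale (of_nat (nat \<bar>k\<bar>)) (Poly_Mapping.single v 1) + e"
  have "Poly_Mapping.lookup f v = of_nat (nat (\<bar>k\<bar> + k))"
    by (simp add: f_def lookup_add k)
  then have "xf f \<in> lam_polys v" by (rule xf_in_lam_polys)
  then show ?thesis unfolding f_def xf_add xf_scale by blast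
qed

text \<open>Factors without \<lambda> are units among the coefficients. A factor with negative
  \<lambda>-exponent is inverted at the cost of a monomial, which is harmless once \<lambda> is
  invertible. What remains in the denominator is a power of \<lambda> and the normalized
  factors.\<close>

lemma frat_val_localized:
  fixes R :: "'k::field frat"
  assumes R: "proper_frat R" "integral_in v R"
  shows "\<exists>d H. H \<in> lam_polys v \<and> frat_val R
    = H / (lam v ^ Suc d * (\<Prod>l\<in>lam_dens v R. 1 - xf (pos_exp v (dexp R l))))"
proof -
  define C :: "'k flaurent fract set" where "C = {x. \<exists>d. lam v ^ d * x \<in> lam_polys v}"
  have C: "is_subring C"
    unfolding C_def by (intro subring_localization subring_lam_polys lam_in_lam_polys)
  have free: "binomial_fractions (free_exps v) \<subseteq> C"
    unfolding C_def using const_in_values_at[OF subring_free_fractions]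
    by (auto intro!: exI[of _ 0])
  have xC: "xf e \<in> C" if "Poly_Mapping.lookup e v \<in> \<int>" for e
    unfolding C_def using xf_localized[OF that] by simp
  let ?D = "\<lambda>l. inverse (1 - xf (pos_exp v (dexp R l))) :: 'k flaurent fract"
  have "of_laurent (numer R) \<in> C"
  proof -
    have "of_laurent (Poly_Mapping.single e c) \<in> C" if "Poly_Mapping.lookup e v \<in> \<int>" for e and c :: 'k
    proof -
      have "(Poly_Mapping.single e c :: 'k flaurent) = Poly_Mapping.single 0 c * xpow e"
        by (simp add: xpow_def mult_single)
      moreover have "of_laurent (Poly_Mapping.single 0 c) \<in> C"
        by (intro subsetD[OF free] of_laurent_in_binomial_fractions) (simp add: laurent_over_def)
      ultimately show ?thesis
        by (simp add: of_laurent_mult subring_mult[OF C] xC that)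
    qed
    then have "of_laurent (\<Sum>e\<in>Poly_Mapping.keys (numer R).
        Poly_Mapping.single e (Poly_Mapping.lookup (numer R) e)) \<in> C"
      unfolding of_laurent_sum using R(2) by (intro subring_sum[OF C]) (auto simp: integral_in_def)
    then show ?thesis
      using laurent_eq_sum_single[of "Poly_Mapping.keys (numer R)" "numer R"] by simp
  qed
  moreover have "\<exists>c\<in>C. inverse (1 - xf (dexp R l)) = c * (if l \<in> lam_dens v R then ?D l else 1)"
    if l: "l \<in> dens R" for l
  proof (cases "l \<in> lam_dens v R")
    case False
    then have "inverse (1 - xf (dexp R l)) \<in> C"
      using l R(1) by (intro subsetD[OF free] inverse_binomial_in_binomial_fractions exp_submonoid_free)
        (auto simp: lam_dens_def proper_frat_def)
    then show ?thesis using False by auto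
  next
    case True
    then have int: "Poly_Mapping.lookup (dexp R l) v \<in> \<int>"
      using l R(2) by (auto simp: integral_in_def)
    show ?thesis
    proof (cases rule: pos_exp_cases[of v "dexp R l"])
      case 1
      then show ?thesis using True subring_one[OF C] by (intro bexI[of _ 1]) auto
    next
      case 2
      have "1 - xf (dexp R l) = - xf (dexp R l) * (1 - xf (- dexp R l) :: 'k flaurent fract)"
        by (simp add: xf_uminus algebra_simps)
      then have "inverse (1 - xf (dexp R l)) = - xf (- dexp R l) * ?D l"
        by (simp add: 2 xf_uminus)
      moreover have "- xf (- dexp R l) \<in> C"
        using int by (intro subring_uminus[OF C] xC) simp
      ultimately show ?thesis unfolding if_P[OF True] by (intro bexI)
    qed
  qed
  then obtain c where c: "\<And>l. l \<in> dens R \<Longrightarrow> c l \<in> C"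
    "\<And>l. l \<in> dens R \<Longrightarrow> inverse (1 - xf (dexp R l)) = c l * (if l \<in> lam_dens v R then ?D l else 1)"
    by metis
  moreover have "(\<Prod>l\<in>dens R. if l \<in> lam_dens v R then ?D l else 1) = (\<Prod>l\<in>lam_dens v R. ?D l)"
    using R(1) by (intro prod.mono_neutral_cong_right) (auto simp: proper_frat_def lam_dens_def)
  ultimately obtain G where G: "G \<in> C" "frat_val R = G * (\<Prod>l\<in>lam_dens v R. ?D l)"
    using frat_val_eq[of R]
    by (intro that[of "of_laurent (numer R) * (\<Prod>l\<in>dens R. c l)"])
      (auto simp: prod.distrib mult_ac intro!: subring_mult[OF C] subring_prod[OF C])
  then obtain d where d: "lam v ^ d * G \<in> lam_polys v" by (auto simp: C_def)
  \<comment> \<open>The additional factor \<lambda> makes the power in the denominator positive even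
    for \<open>d = 0\<close>, as the bound \<open>degree q < t\<close> and the division by
    \<open>monom 1 (Suc d)\<close> require.\<close>
  have "lam v * (lam v ^ d * G) \<in> lam_polys v"
    by (intro subring_mult[OF subring_lam_polys] lam_in_lam_polys d)
  moreover have "(\<Prod>l\<in>lam_dens v R. ?D l) = inverse (\<Prod>l\<in>lam_dens v R. 1 - xf (pos_exp v (dexp R l)))"
    by (simp add: prod_inversef[symmetric])
  ultimately show ?thesis
    using G(2) by (intro exI[of _ d] exI[of _ "lam v * (lam v ^ d * G)"]) (simp add: field_simps)
qed

lemma integral_in_imp_integral_dens: "integral_in v R \<Longrightarrow> integral_dens v R"
  by (auto simp: integral_in_def integral_dens_def)

lemma pos_exp_nonzero: "l \<in> lam_dens v R \<Longrightarrow> pos_exp v (dexp R l) \<noteq> 0"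
  by (metis (mono_tags, lifting) abs_eq_0_iff lam_dens_def lookup_pos_exp lookup_zero mem_Collect_eq)

text \<open>The comaximal splitting gives numerators of uncontrolled degree. They are reduced by
  division, which is possible over \<open>C\<close> because the leading coefficients are 1 and minus
  a monomial; the quotients are collected in \<open>P\<close>. Membership in \<open>C\<close> is
  recorded because \<open>Z_fract\<close> has to be applied to the coefficients.\<close>

lemma partial_fractions_exist:
  fixes R :: "'k::field frat"
  assumes R: "proper_frat R" "coprime_dens R" "integral_in v R"
  defines "C \<equiv> polys (binomial_fractions (free_exps v)) :: 'k flaurent fract poly set"
  shows "\<exists>P q t A. partial_fractions v R P q t A \<and> P \<in> C \<and> q \<in> C \<and> (\<forall>l\<in>lam_dens v R. A l \<in> C)"
proof -
  note int = integral_in_imp_integral_dens[OF R(3)]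
  note F = subring_free_fractions[of v, where 'a = 'k]
  note P = subring_polys[OF F, folded C_def]
  note O = subring_lam_polys[of v, where 'a = 'k]
  let ?S = "lam_dens v R"
  let ?e = "\<lambda>l. pos_exp v (dexp R l)"
  let ?g = "\<lambda>l. 1 - xf (?e l) :: 'k flaurent fract"
  have S: "l \<in> dens R" if "l \<in> ?S" for l using that by (simp add: lam_dens_def)
  have fin: "finite ?S" using R(1) by (simp add: proper_frat_def lam_dens_def)
  note deg = lookup_pos_exp_lam_deg[OF int S]
  have g0: "?g l \<noteq> 0" if "l \<in> ?S" for l
    using xf_eq_1_iff[of "?e l", where 'a = 'k] pos_exp_nonzero[OF that] by simp
  from frat_val_localized[OF R(1,3)] obtain d H where H: "H \<in> lam_polys v"
    "frat_val R = H / (lam v ^ Suc d * prod ?g ?S)" by blast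
  have "\<exists>h0 h. h0 \<in> lam_polys v \<and> (\<forall>l\<in>?S. h l \<in> lam_polys v) \<and>
      H / (lam v ^ Suc d * prod ?g ?S) = h0 / lam v ^ Suc d + (\<Sum>l\<in>?S. h l / ?g l)"
    by (intro comaximal_split O fin H g0 comaximal_dens int R comaximal_lam_binomial[OF deg]
        lam_deg_pos) auto
  then obtain h0 h where h: "h0 \<in> lam_polys v" "\<forall>l\<in>?S. h l \<in> lam_polys v"
    "frat_val R = h0 / lam v ^ Suc d + (\<Sum>l\<in>?S. h l / ?g l)"
    unfolding H(2) by blast
  from h(1) obtain p0 where p0: "p0 \<in> C" "h0 = poly p0 (lam v)"
    unfolding values_at_def C_def by blast
  have "\<exists>s q. s \<in> C \<and> q \<in> C \<and> degree q < degree (monom 1 (Suc d) :: 'k flaurent fract poly)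
      \<and> p0 = s * monom 1 (Suc d) + q"
    using p0(1) unfolding C_def
    by (intro polys_division F monom_in_polys subring_one[OF F])
      (auto simp: degree_monom_eq intro: subring_one[OF F])
  then obtain s0 q where q: "s0 \<in> C" "q \<in> C" "degree q < Suc d" "p0 = s0 * monom 1 (Suc d) + q"
    by (auto simp: degree_monom_eq)
  have "\<exists>s A. s \<in> C \<and> A \<in> C \<and> degree A < lam_deg v R l \<and> h l = poly s (lam v) * ?g l + poly A (lam v)"
    if l: "l \<in> ?S" for l
  proof -
    from h(2) l obtain p where p: "p \<in> C" "h l = poly p (lam v)"
      unfolding values_at_def C_def by blast
    let ?f = "1 - xf_poly v (?e l) :: 'k flaurent fract poly"
    note dl = degree_one_minus_xf_poly[OF deg[OF l] lam_deg_pos[OF int l], where 'k = 'k]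
    have "inverse (lead_coeff ?f) \<in> binomial_fractions (free_exps v)"
    proof -
      have "inverse (lead_coeff ?f) = - xf (- free_part v (?e l))"
        unfolding dl(2) by (simp add: xf_uminus)
      then show ?thesis
        by (auto intro!: subring_uminus[OF F] xf_in_binomial_fractions simp: lookup_free_part)
    qed
    moreover have "?f \<in> C"
      unfolding C_def
      by (intro subring_diff[OF subring_polys[OF F]] subring_one[OF subring_polys[OF F]]
          xf_poly_in_polys)
    ultimately obtain s A where "s \<in> C" "A \<in> C" "degree A < lam_deg v R l" "p = s * ?f + A"
      using polys_division[OF F, of ?f p] p(1) lam_deg_pos[OF int l] unfolding C_def dl(1) by blast
    then show ?thesis
      unfolding p(2)
      by (intro exI[of _ s] exI[of _ A]) (simp add: poly_xf_poly[OF deg[OF l]])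
  qed
  then obtain s A where sA: "\<And>l. l \<in> ?S \<Longrightarrow> s l \<in> C" "\<And>l. l \<in> ?S \<Longrightarrow> A l \<in> C"
    "\<And>l. l \<in> ?S \<Longrightarrow> degree (A l) < lam_deg v R l"
    "\<And>l. l \<in> ?S \<Longrightarrow> h l = poly (s l) (lam v) * ?g l + poly (A l) (lam v)"
    by metis
  define P where "P = s0 + (\<Sum>l\<in>?S. s l)"
  have PC: "P \<in> C" unfolding P_def by (intro subring_add[OF P] subring_sum[OF P] q sA)
  have "h l / ?g l = poly (s l) (lam v) + poly (A l) (lam v) / ?g l" if "l \<in> ?S" for l
    using g0[OF that] by (simp add: sA(4)[OF that] add_divide_distrib)
  then have "(\<Sum>l\<in>?S. h l / ?g l) = poly (\<Sum>l\<in>?S. s l) (lam v) + (\<Sum>l\<in>?S. poly (A l) (lam v) / ?g l)"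
    by (simp add: poly_sum sum.distrib)
  moreover have "h0 / lam v ^ Suc d = poly s0 (lam v) + poly q (lam v) / lam v ^ Suc d"
    unfolding p0(2) q(4) by (simp add: poly_monom add_divide_distrib)
  ultimately have "frat_val R = poly P (lam v) + poly q (lam v) / lam v ^ Suc d
      + (\<Sum>l\<in>?S. poly (A l) (lam v) / ?g l)"
    unfolding h(3) P_def by simp
  moreover have "C \<subseteq> polys {F. free_of v F}"
    unfolding C_def polys_def using free_of_binomial_fractions by blast
  ultimately have "partial_fractions v R P q (Suc d) A"
    unfolding partial_fractions_iff[OF int] using PC q sA by auto
  then show ?thesis using PC q(2) sA(2) by blast
qed


section \<open>Uniqueness of the partial fraction decomposition\<close>

text \<open>The coefficient ring \<open>K\<close> is all of \<open>free_of\<close>, since the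
  competing decompositions in \<open>CT\<close> are restricted no further. The Bezout identities
  from the smaller ring remain valid there. Integrality of \<open>B j / g j\<close> plus
  transcendence of \<lambda> turn the comparison into divisibility of polynomials.\<close>

lemma partial_fractions_unique:
  fixes R :: "'k::field frat"
  assumes R: "finite (dens R)" "coprime_dens R" "integral_dens v R" and j: "j \<in> lam_dens v R"
    and 1: "partial_fractions v R P q t A" and 2: "partial_fractions v R P' q' t' A'"
  shows "A j = A' j"
proof -
  define K :: "'k flaurent fract set" where "K = {F. free_of v F}"
  have K: "is_subring K" unfolding K_def by (rule subring_free_of)
  have sub: "binomial_fractions (free_exps v) \<subseteq> K"
    unfolding K_def by (rule free_of_binomial_fractions)
  note PK = subring_polys[OF K]
  define C where "C = values_at (lam v) K"
  note C = subring_values_at[OF K, of "lam v", folded C_def]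
  have subC: "lam_polys v \<subseteq> C" unfolding C_def by (intro values_at_mono sub)
  let ?S = "lam_dens v R"
  let ?e = "\<lambda>l. pos_exp v (dexp R l)"
  let ?g = "\<lambda>l. 1 - xf (?e l) :: 'k flaurent fract"
  note 1 = 1[unfolded partial_fractions_iff[OF R(3)], folded K_def]
    and 2 = 2[unfolded partial_fractions_iff[OF R(3)], folded K_def]
  have S: "l \<in> dens R" if "l \<in> ?S" for l using that by (simp add: lam_dens_def)
  note deg = lookup_pos_exp_lam_deg[OF R(3) S]
  have g0: "?g l \<noteq> 0" if "l \<in> ?S" for l
    using xf_eq_1_iff[of "?e l", where 'a = 'k] pos_exp_nonzero[OF that] by simp
  have gC: "?g l \<in> C" if "l \<in> ?S" for l
    by (intro subsetD[OF subC] subring_diff[OF subring_lam_polys] subring_one[OF subring_lam_polys]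
        xf_in_lam_polys[OF deg[OF that]])
  define B where "B l = A l - A' l" for l
  have B: "B l \<in> polys K" "degree (B l) < lam_deg v R l" if "l \<in> ?S" for l
    using 1 2 that by (auto simp: B_def intro: subring_diff[OF PK] degree_diff_less)
  let ?x = "lam v :: 'k flaurent fract"
  \<comment> \<open>\<open>H / ?x ^ (t + t')\<close> is the difference of the polynomial parts and
    \<lambda>-power parts of the two decompositions, over a common power of \<lambda>.\<close>
  define H where "H = poly (P - P') ?x * ?x ^ (t + t') + poly q ?x * ?x ^ t' - poly q' ?x * ?x ^ t"
  have xC: "?x \<in> C" unfolding C_def by (rule point_in_values_at[OF K])
  have pC: "poly p ?x \<in> C" if "p \<in> polys K" for p
    unfolding C_def by (rule poly_in_values_at[OF that])
  have HC: "H \<in> C"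
    unfolding H_def using 1 2 by (auto intro!: subring_intros[OF C] xC pC subring_diff[OF PK])
  have "H / ?x ^ (t + t')
      = (poly P ?x + poly q ?x / ?x ^ t) - (poly P' ?x + poly q' ?x / ?x ^ t')"
    by (simp add: H_def power_add field_simps)
  moreover have "(\<Sum>l\<in>?S. poly (B l) ?x / ?g l)
      = (\<Sum>l\<in>?S. poly (A l) ?x / ?g l) - (\<Sum>l\<in>?S. poly (A' l) ?x / ?g l)"
    by (simp add: B_def diff_divide_distrib sum_subtractf)
  moreover have "poly P ?x + poly q ?x / ?x ^ t + (\<Sum>l\<in>?S. poly (A l) ?x / ?g l)
      = poly P' ?x + poly q' ?x / ?x ^ t' + (\<Sum>l\<in>?S. poly (A' l) ?x / ?g l)"
    using 1 2 by metis
  ultimately have eq: "H / ?x ^ (t + t') + (\<Sum>l\<in>?S. poly (B l) ?x / ?g l) = 0"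
    by (simp only: add_diff_add[symmetric] diff_self)
  have "poly (B j) ?x / ?g j \<in> C"
  proof (rule partial_fraction_integral[OF C _ j _ _ HC, where B = "\<lambda>l. poly (B l) ?x"])
    show "finite ?S" using R(1) by (simp add: lam_dens_def)
    show "?x ^ (t + t') \<in> C" by (intro subring_power[OF C] xC)
    show "comaximal C (?g j) (?x ^ (t + t'))"
      by (rule comaximal_mono[OF comaximal_sym[OF comaximal_lam_binomial[OF
          deg[OF j] lam_deg_pos[OF R(3) j]]] subC])
    show "comaximal C (?g j) (?g l)" if "l \<in> ?S" "l \<noteq> j" for l
      using that by (intro comaximal_mono[OF comaximal_dens subC] R j) auto
  qed (use eq gC g0 B pC in auto)
  then obtain z where z: "z \<in> polys K" "poly (B j) ?x / ?g j = poly z ?x"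
    unfolding C_def values_at_def by blast
  let ?f = "1 - xf_poly v (?e j) :: 'k flaurent fract poly"
  have "xf_poly v (?e j) \<in> polys K"
    using xf_poly_in_polys sub unfolding polys_def by blast
  then have "B j - ?f * z \<in> polys K"
    by (intro subring_diff[OF PK] subring_mult[OF PK] subring_one[OF PK] B j z)
  moreover have "poly (B j - ?f * z) ?x = 0"
    using z(2) g0[OF j] by (simp add: poly_xf_poly[OF deg[OF j]] field_simps)
  ultimately have Bfz: "B j - ?f * z = 0"
    unfolding K_def by (rule lam_transcendental)
  \<comment> \<open>A nonzero multiple of \<open>?f\<close> has degree at least
    \<open>lam_deg v R j\<close>, but \<open>B j\<close> has smaller degree.\<close>
  have "z = 0"
  proof (rule ccontr)
    assume "z \<noteq> 0"
    note df = degree_one_minus_xf_poly(1)[OF deg[OF j] lam_deg_pos[OF R(3) j], where 'k = 'k]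
    then have "?f \<noteq> 0" using lam_deg_pos[OF R(3) j] by (metis degree_0 less_irrefl)
    then have "degree (B j) = lam_deg v R j + degree z"
      using Bfz \<open>z \<noteq> 0\<close> by (simp add: degree_mult_eq df)
    then show False using B(2)[OF j] by simp
  qed
  then show ?thesis using Bfz by (simp add: B_def)
qed

section \<open>Substitution of powers in a decomposition\<close>

lemma stretch_fract_lam:
  assumes m: "0 < m"
  shows "stretch_fract v m (lam v) = lam v ^ m"
proof -
  have "stretch_exp v m (Poly_Mapping.single v 1) = scale (of_nat m) (Poly_Mapping.single v 1)"
    by (rule poly_mapping_eqI) (simp add: lookup_stretch_exp lookup_single when_def)
  then show ?thesis by (simp add: stretch_fract_of_laurent[OF m] xf_scale)
qed

text \<open>Coefficients are \<lambda>-free and hence fixed; only the evaluation point changes,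
  which amounts to composing with the \<open>m\<close>th power of the variable.\<close>

lemma stretch_fract_poly:
  assumes m: "0 < m" and "p \<in> polys {F. free_of v F}"
  shows "stretch_fract v m (poly p (lam v)) = poly (pcompose p (monom 1 m)) (lam v)"
proof -
  have "stretch_fract v m (poly p (lam v)) = poly p (lam v ^ m)"
    using assms(2)
  proof (induction p)
    case 0
    then show ?case by (simp add: stretch_fract_zero[OF m])
  next
    case (pCons c p)
    then show ?case
      by (simp add: pCons_in_polys_iff stretch_fract_add[OF m] stretch_fract_mult[OF m] stretch_fract_lam[OF m]
          stretch_fract_free[OF m])
  qed
  then show ?thesis by (simp add: poly_pcompose poly_monom)
qed

lemma lam_dens_stretch: "0 < m \<Longrightarrow> lam_dens v (stretch v m R) = lam_dens v R"
  by (auto simp: lam_dens_def stretch_def lookup_stretch_exp)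

lemma proper_frat_stretch: "0 < m \<Longrightarrow> proper_frat (stretch v m R) \<longleftrightarrow> proper_frat R"
  using stretch_exp_eq_iff[of m v _ 0] by (simp add: proper_frat_def stretch_def)

lemma coprime_dens_stretch: "0 < m \<Longrightarrow> coprime_dens (stretch v m R) \<longleftrightarrow> coprime_dens R"
  by (simp add: coprime_dens_def stretch_def stretch_exp_eq_iff flip: stretch_exp_scale)

lemma integral_dens_stretch: "integral_dens v R \<Longrightarrow> integral_dens v (stretch v m R)"
  by (simp add: integral_dens_def stretch_def lookup_stretch_exp)

lemma lam_deg_stretch:
  assumes "integral_dens v R" "l \<in> dens R"
  shows "lam_deg v (stretch v m R) l = m * lam_deg v R l"
proof -
  obtain k where "Poly_Mapping.lookup (dexp R l) v = of_int k"
    using assms by (auto simp: integral_dens_def elim: Ints_cases)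
  moreover have "of_nat m * of_int k = (of_int (int m * k) :: rat)" by simp
  ultimately show ?thesis
    by (simp add: lam_deg_def stretch_def lookup_stretch_exp nat_mult_distrib abs_mult
        del: of_int_mult)
qed

text \<open>Numerator degrees, denominator degrees and \<open>t\<close> are all multiplied by
  \<open>m\<close>, so the strict bounds persist for positive \<open>m\<close>.\<close>

lemma partial_fractions_stretch:
  fixes R :: "'k::field frat"
  assumes m: "0 < m" and R: "proper_frat R" "integral_dens v R"
    and pf: "partial_fractions v R P q t A"
  defines "\<phi> \<equiv> \<lambda>p. pcompose p (monom 1 m)"
  shows "partial_fractions v (stretch v m R) (\<phi> P) (\<phi> q) (m * t) (\<lambda>l. \<phi> (A l))"
proof -
  note pf = pf[unfolded partial_fractions_iff[OF R(2)]]
  note F = subring_free_of[of v, where 'a = 'k]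
  let ?K = "polys {F. free_of v F} :: 'k flaurent fract poly set"
  have \<phi>: "\<phi> p \<in> ?K" if "p \<in> ?K" for p
    unfolding \<phi>_def by (intro pcompose_in_polys F that monom_in_polys subring_one[OF F])
  have deg: "degree (\<phi> p) = m * degree p" for p
    by (simp add: \<phi>_def degree_pcompose degree_monom_eq)
  let ?\<sigma> = "stretch_fract v m :: 'k flaurent fract \<Rightarrow> _"
  have "frat_val (stretch v m R) = ?\<sigma> (frat_val R)"
    using stretch_fract_frat_val[OF m R(1)] by simp
  also have "\<dots> = ?\<sigma> (poly P (lam v)) + ?\<sigma> (poly q (lam v)) / (lam v ^ m) ^ t
      + (\<Sum>l\<in>lam_dens v R. ?\<sigma> (poly (A l) (lam v)) / (1 - ?\<sigma> (xf (pos_exp v (dexp R l)))))"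
    using pf by (simp add: stretch_fract_add[OF m] stretch_fract_sum[OF m] stretch_fract_divide[OF m]
        stretch_fract_diff[OF m] stretch_fract_one[OF m] stretch_fract_power[OF m]
        stretch_fract_lam[OF m])
  also have "\<dots> = poly (\<phi> P) (lam v) + poly (\<phi> q) (lam v) / lam v ^ (m * t)
      + (\<Sum>l\<in>lam_dens v (stretch v m R).
          poly (\<phi> (A l)) (lam v) / (1 - xf (pos_exp v (dexp (stretch v m R) l))))"
    using pf unfolding lam_dens_stretch[OF m]
    by (auto simp: stretch_fract_poly[OF m] \<phi>_def power_mult stretch_def pos_exp_stretch_exp[OF m]
        stretch_fract_of_laurent[OF m] intro!: sum.cong)
  finally show ?thesis
    unfolding partial_fractions_iff[OF integral_dens_stretch[OF R(2)]]
    using pf m lam_deg_stretch[OF R(2)]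
    by (simp add: \<phi> deg lam_dens_stretch[OF m]) (simp add: lam_dens_def)
qed

text \<open>Any single decomposition computes \<open>CT\<close>. A competitor with another
  \<open>m'\<close> is compared at \<open>m * m'\<close>, where uniqueness applies; composing a
  numerator with a positive power of the variable leaves its value at 0 unchanged.\<close>

lemma CT_eq:
  fixes R :: "'k::field frat"
  assumes R: "proper_frat R" "coprime_dens R" and j: "j \<in> lam_dens v R"
    and m: "0 < m" "integral_in v (stretch v m R)"
    and pf: "partial_fractions v (stretch v m R) P q t A"
  shows "CT v j R = poly (A j) 0"
  unfolding CT_def
proof (rule the_equality)
  fix c assume "\<exists>m P q t A. 0 < m \<and> integral_in v (stretch v m R) \<and>
      partial_fractions v (stretch v m R) P q t A \<and> c = poly (A j) 0"
  then obtain m' P' q' t' A' where m': "0 < m'" "integral_in v (stretch v m' R)"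
    and pf': "partial_fractions v (stretch v m' R) P' q' t' A'" and c: "c = poly (A' j) 0"
    by blast
  note int = integral_in_imp_integral_dens[OF m(2)] integral_in_imp_integral_dens[OF m'(2)]
  have mm: "0 < m * m'" using m m' by simp
  let ?T = "stretch v (m * m') R"
  have pf1: "partial_fractions v ?T (pcompose P (monom 1 m')) (pcompose q (monom 1 m')) (m' * t)
      (\<lambda>l. pcompose (A l) (monom 1 m'))"
    using partial_fractions_stretch[OF m'(1) _ int(1) pf] R(1) m(1)
    by (simp add: stretch_stretch proper_frat_stretch mult.commute[of m m'])
  have pf2: "partial_fractions v ?T (pcompose P' (monom 1 m)) (pcompose q' (monom 1 m)) (m * t')
      (\<lambda>l. pcompose (A' l) (monom 1 m))"
    using partial_fractions_stretch[OF m(1) _ int(2) pf'] R(1) m'(1)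
    by (simp add: stretch_stretch proper_frat_stretch)
  have fin: "finite (dens ?T)"
    using R(1) by (simp add: proper_frat_def stretch_def)
  have T: "coprime_dens ?T" "integral_dens v ?T" "j \<in> lam_dens v ?T"
    using R j integral_dens_stretch[OF int(2), of m]
    by (simp_all only: coprime_dens_stretch[OF mm] lam_dens_stretch[OF mm] stretch_stretch)
  have "pcompose (A j) (monom 1 m') = pcompose (A' j) (monom 1 m)"
    by (rule partial_fractions_unique[OF fin T pf1 pf2])
  then have "poly (pcompose (A j) (monom 1 m')) 0 = poly (pcompose (A' j) (monom 1 m)) 0" by simp
  then show "c = poly (A j) 0"
    using m m' by (simp add: c poly_pcompose poly_monom zero_power)
qed (use m pf in blast)


section \<open>Linearity of \<open>\<Z>\<^sub>y\<close> on rational functions\<close>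

abbreviation Z_domain :: "'k::field flaurent fract set" where
  "Z_domain \<equiv> binomial_fractions UNIV"

lemma subring_Z_domain: "is_subring Z_domain"
  by (intro subring_binomial_fractions exp_submonoid_UNIV)

lemma free_fractions_Z_domain: "binomial_fractions (free_exps v) \<subseteq> Z_domain"
  by (intro binomial_fractions_mono) simp

lemma proper_frat_clears: "proper_frat R \<Longrightarrow> \<exists>p. clears n R p"
  by (simp add: proper_frat_def clears_exists)

lemma Z_domain_cleared:
  assumes "F \<in> Z_domain"
  obtains N D where "F = Fract N D" "D \<noteq> 0" "Z_y n D = D"
proof -
  from assms obtain R where R: "proper_frat R" "frat_val R = F"
    by (rule binomial_fractions_frat_val)
  obtain p where p: "clears n R p"
    using proper_frat_clears[OF R(1)] by blast
  show ?thesis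
    using frat_val_cleared[OF R(1) p] R(2) by (intro that) auto
qed

text \<open>Frees computations from binomial denominators: any denominator fixed by
  \<open>Z_y\<close> will do, because \<open>Z_y\<close> is linear over fixed Laurent polynomials
  and so respects cross-multiplication. Membership in \<open>Z_domain\<close> supplies the
  presentation that the definition of \<open>Z_fract\<close> demands.\<close>

lemma Z_fract_Fract:
  assumes "Fract N D \<in> Z_domain" "D \<noteq> 0" "Z_y n D = D"
  shows "Z_fract n (Fract N D) = Fract (Z_y n N) D"
proof -
  from assms(1) obtain R where R: "proper_frat R" "frat_val R = Fract N D"
    by (rule binomial_fractions_frat_val)
  obtain p where p: "clears n R p"
    using proper_frat_clears[OF R(1)] by blast
  note c = frat_val_cleared[OF R(1) p]
  define N' where "N' = numer R * (\<Prod>j\<in>dens R. \<Sum>t<p j. xpow (dexp R j) ^ t)"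
  define D' where "D' = (\<Prod>j\<in>dens R. 1 - xpow (scale (of_nat (p j)) (dexp R j)) :: 'a flaurent)"
  note c = c[folded N'_def D'_def]
  have "N' * D = N * D'"
    using c(1,3) R(2) assms(2) by (simp add: eq_fract)
  then have "Z_y n N' * D = Z_y n N * D'"
    using Z_y_mult[OF c(2), of N] Z_y_mult[OF assms(3), of N'] by simp
  then show ?thesis
    using Z_fract_frat_val[OF R(1) p] R(2) c assms(2) by (simp add: eq_fract)
qed

lemma Z_fract_add:
  assumes "F \<in> Z_domain" "G \<in> Z_domain"
  shows "Z_fract n (F + G) = Z_fract n F + Z_fract n G"
proof -
  obtain N D where F: "F = Fract N D" "D \<noteq> 0" "Z_y n D = D"
    using assms(1) by (rule Z_domain_cleared)
  obtain N' D' where G: "G = Fract N' D'" "D' \<noteq> 0" "Z_y n D' = D'"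
    using assms(2) by (rule Z_domain_cleared)
  have "F + G = Fract (N * D' + N' * D) (D * D')" using F G by simp
  moreover have "Z_y n (D * D') = D * D'" by (simp add: Z_y_mult F G)
  ultimately have "Z_fract n (F + G) = Fract (Z_y n (N * D' + N' * D)) (D * D')"
    using subring_add[OF subring_Z_domain assms] F(2) G(2) by (simp add: Z_fract_Fract)
  also have "\<dots> = Fract (Z_y n N) D + Fract (Z_y n N') D'"
    using F G by (simp add: Z_y_add Z_y_mult)
  finally show ?thesis using F G assms by (simp add: Z_fract_Fract)
qed

lemma Z_fract_zero [simp]: "Z_fract n 0 = (0 :: 'k::field flaurent fract)"
proof -
  have "(0 :: 'k flaurent fract) \<in> Z_domain" by (rule subring_zero[OF subring_Z_domain])
  then have "Z_fract n (0 :: 'k flaurent fract) = Z_fract n 0 + Z_fract n 0"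
    using Z_fract_add[of "0 :: 'k flaurent fract" 0 n] by simp
  then show ?thesis by (simp only: add_cancel_right_right)
qed

lemma Z_fract_sum:
  "(\<And>l. l \<in> S \<Longrightarrow> f l \<in> Z_domain) \<Longrightarrow> Z_fract n (\<Sum>l\<in>S. f l) = (\<Sum>l\<in>S. Z_fract n (f l))"
  by (induction S rule: infinite_finite_induct)
    (auto simp: Z_fract_add subring_sum[OF subring_Z_domain])

text \<open>The scalars over which \<open>Z_fract\<close> is linear. Fixed polynomials are allowed
  in numerator and denominator alike, which gives closure under inverses.\<close>

definition Z_scalars :: "nat \<Rightarrow> 'k::field flaurent fract set" where
  "Z_scalars n = fractions {L. Z_y n L = L} ({L. Z_y n L = L} - {0})"

lemma subring_Z_scalars: "is_subring (Z_scalars n :: 'k::field flaurent fract set)"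
proof -
  have "Z_y n (1 :: 'k flaurent) = 1" by (simp add: Z_y_idem_iff)
  moreover have "Z_y n (0 :: 'k flaurent) = 0" by (simp add: Z_y_idem_iff)
  moreover have "Z_y n (- L) = - L" if "Z_y n L = L" for L :: "'k flaurent"
    using that by (simp add: Z_y_idem_iff)
  ultimately have "is_subring {L. Z_y n L = (L :: 'k flaurent)}"
    by (intro is_subringI) (auto simp: Z_y_add Z_y_mult)
  then show ?thesis
    unfolding Z_scalars_def using \<open>Z_y n 1 = (1 :: 'k flaurent)\<close>
    by (intro subring_fractions) (auto simp: Z_y_mult)
qed

lemma inverse_Z_scalars:
  assumes "F \<in> Z_scalars n"
  shows "inverse F \<in> Z_scalars n"
proof (cases "F = 0")
  case False
  obtain a d where F: "F = Fract a d" "Z_y n a = a" "Z_y n d = d" "d \<noteq> 0"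
    using assms by (auto simp: Z_scalars_def fractions_def)
  with False have "a \<noteq> 0" by (auto simp: Zero_fract_def eq_fract)
  with F show ?thesis by (auto simp: Z_scalars_def intro!: Fract_in_fractions)
qed (simp add: subring_zero[OF subring_Z_scalars])

lemma xf_in_Z_scalars:
  assumes "\<And>w. w < n \<Longrightarrow> Poly_Mapping.lookup e w \<in> \<int>"
  shows "xf e \<in> Z_scalars n"
  using assms unfolding Z_scalars_def of_laurent_def
  by (intro Fract_in_fractions) (auto simp: xpow_def Z_y_single Z_y_idem_iff)

text \<open>The two conditions on \<open>C\<close> do different work: \<open>Z_scalars\<close> lets
  it pass through \<open>Z_y\<close>, and \<open>Z_domain\<close> keeps the product where
  \<open>Z_fract\<close> is determined.\<close>

lemma Z_fract_mult:
  assumes F: "F \<in> Z_domain" and C: "C \<in> Z_scalars n" "C \<in> Z_domain"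
  shows "Z_fract n (F * C) = Z_fract n F * C"
proof -
  obtain N D where F': "F = Fract N D" "D \<noteq> 0" "Z_y n D = D"
    using F by (rule Z_domain_cleared)
  from C(1) obtain c d where C': "C = Fract c d" "Z_y n c = c" "Z_y n d = d" "d \<noteq> 0"
    by (auto simp: Z_scalars_def fractions_def)
  have "F * C = Fract (N * c) (D * d)" by (simp add: F' C')
  then have "Z_fract n (F * C) = Fract (Z_y n (N * c)) (D * d)"
    using subring_mult[OF subring_Z_domain F C(2)] F'(2,3) C'(3,4)
    by (simp add: Z_fract_Fract Z_y_mult)
  then show ?thesis using F F' C' by (simp add: Z_fract_Fract Z_y_mult)
qed

text \<open>A presentation with \<lambda>-free exponents exists, clearing only rescales these
  exponents, and \<open>Z_y\<close> only deletes terms. Being \<lambda>-free is exactly what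
  \<open>partial_fractions\<close> asks of a coefficient.\<close>

lemma Z_fract_free:
  assumes "F \<in> binomial_fractions (free_exps v)"
  shows "free_of v (Z_fract n F)"
proof -
  note L = subring_laurent_over[OF exp_submonoid_free[of v], where 'k = 'a]
  from assms obtain R where R: "proper_frat R" "frat_val R = F"
      "Poly_Mapping.keys (numer R) \<subseteq> free_exps v" "dexp R ` dens R \<subseteq> free_exps v"
    by (rule binomial_fractions_frat_val)
  obtain p where p: "clears n R p"
    using proper_frat_clears[OF R(1)] by blast
  define N where "N = numer R * (\<Prod>j\<in>dens R. \<Sum>t<p j. xpow (dexp R j) ^ t)"
  define D where "D = (\<Prod>j\<in>dens R. 1 - xpow (scale (of_nat (p j)) (dexp R j)) :: 'a flaurent)"
  note c = frat_val_cleared[OF R(1) p, folded N_def D_def]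
  have "N \<in> laurent_over (free_exps v)"
    unfolding N_def using R(3,4)
    by (intro subring_mult[OF L] subring_prod[OF L] subring_sum[OF L] subring_power[OF L]
        xpow_in_laurent_over) (auto simp: laurent_over_def)
  then have "Z_y n N \<in> laurent_over (free_exps v)"
    by (force simp: laurent_over_def in_keys_iff lookup_Z_y split: if_splits)
  moreover have "D \<in> laurent_over (free_exps v)"
    unfolding D_def using R(4)
    by (intro subring_prod[OF L] subring_diff[OF L] subring_one[OF L] xpow_in_laurent_over) auto
  ultimately have "Fract (Z_y n N) D \<in> {F. free_of v F}"
    using c(1) by (auto simp: free_of_iff intro!: Fract_in_fractions)
  then show ?thesis
    using Z_fract_frat_val[OF R(1) p] R(2) c by simp
qed

section \<open>Polynomials in \<lambda> under \<open>Z_fract\<close>\<close>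

lemma lam_in_Z_domain: "lam v \<in> Z_domain" "inverse (lam v) \<in> Z_domain"
  unfolding xf_uminus[symmetric] by (intro xf_in_binomial_fractions UNIV_I)+

lemma lam_in_Z_scalars: "n \<le> v \<Longrightarrow> lam v \<in> Z_scalars n"
  by (intro xf_in_Z_scalars) (auto simp: lookup_single when_def)

lemma poly_lam_in_Z_domain:
  assumes "p \<in> polys (binomial_fractions (free_exps v))"
  shows "poly p (lam v) \<in> Z_domain"
  unfolding poly_altdef using assms free_fractions_Z_domain[of v]
  by (intro subring_sum[OF subring_Z_domain] subring_mult[OF subring_Z_domain]
      subring_power[OF subring_Z_domain] lam_in_Z_domain) (auto simp: polys_def)

text \<open>Since \<open>n \<le> v\<close>, \<lambda> is a scalar for \<open>Z_fract\<close>, and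
  the Horner form lets the operator move to the coefficients one at a time.\<close>

lemma Z_fract_poly:
  fixes p :: "'k::field flaurent fract poly"
  assumes "n \<le> v" and "p \<in> polys (binomial_fractions (free_exps v))"
  shows "Z_fract n (poly p (lam v)) = poly (map_poly (Z_fract n) p) (lam v)"
  using assms(2)
proof (induction p)
  case 0
  then show ?case by simp
next
  case (pCons c p)
  then have c: "c \<in> Z_domain" "p \<in> polys (binomial_fractions (free_exps v))"
    using free_fractions_Z_domain[of v] by (auto simp: pCons_in_polys_iff)
  have "Z_fract n (poly (pCons c p) (lam v)) = Z_fract n (c + poly p (lam v) * lam v)"
    by (simp add: mult.commute)
  also have "\<dots> = Z_fract n c + Z_fract n (poly p (lam v)) * lam v"
  proof -
    note lam = lam_in_Z_domain(1)[of v, where 'a = 'k] and p = poly_lam_in_Z_domain[OF c(2)]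
    have "poly p (lam v) * lam v \<in> Z_domain"
      by (intro subring_mult[OF subring_Z_domain] p lam)
    then show ?thesis
      by (simp only: Z_fract_add[OF c(1)] Z_fract_mult[OF p lam_in_Z_scalars[OF assms(1)] lam])
  qed
  also have "\<dots> = poly (map_poly (Z_fract n) (pCons c p)) (lam v)"
    using pCons c by (simp add: map_poly_pCons)
  finally show ?case .
qed

lemma map_poly_Z_in_polys:
  "p \<in> polys (binomial_fractions (free_exps v)) \<Longrightarrow> map_poly (Z_fract n) p \<in> polys {F. free_of v F}"
  by (simp add: polys_def coeff_map_poly Z_fract_free)


section \<open>Compatibility of \<open>\<Z>\<^sub>y\<close> with partial fractions\<close>

lemma lam_dens_Z_frat: "clears n R p \<Longrightarrow> lam_dens v (Z_frat n p R) = lam_dens v R"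
  by (auto simp: lam_dens_def Z_frat_def clears_def)

lemma coprime_dens_Z_frat: "clears n R p \<Longrightarrow> coprime_dens R \<Longrightarrow> coprime_dens (Z_frat n p R)"
  by (auto simp: coprime_dens_def Z_frat_def clears_def scale_scale)

lemma proper_frat_Z_frat:
  assumes "clears n R p" "proper_frat R"
  shows "proper_frat (Z_frat n p R)"
proof -
  have "scale (of_nat (p j)) (dexp R j) \<noteq> 0" if "j \<in> dens R" for j
  proof
    assume "scale (of_nat (p j)) (dexp R j) = 0"
    then have "of_nat (p j) * Poly_Mapping.lookup (dexp R j) w = 0" for w
      by (metis lookup_scale lookup_zero)
    then have "dexp R j = 0"
      using assms(1) that by (intro poly_mapping_eqI) (auto simp: clears_def)
    then show False using assms(2) that by (simp add: proper_frat_def)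
  qed
  then show ?thesis using assms(2) by (simp add: proper_frat_def Z_frat_def)
qed

lemma integral_in_Z_frat:
  fixes R :: "'k::field frat"
  assumes "integral_in v R"
  shows "integral_in v (Z_frat n p R)"
proof -
  let ?W = "{e. Poly_Mapping.lookup e v \<in> \<int>}"
  note L = subring_laurent_over[OF exp_submonoid_integral[of v], where 'k = 'k]
  have "numer R * (\<Prod>j\<in>dens R. \<Sum>t<p j. xpow (dexp R j) ^ t) \<in> laurent_over ?W"
    using assms
    by (intro subring_mult[OF L] subring_prod[OF L] subring_sum[OF L] subring_power[OF L]
        xpow_in_laurent_over) (auto simp: laurent_over_def integral_in_def)
  then have "Z_y n (numer R * (\<Prod>j\<in>dens R. \<Sum>t<p j. xpow (dexp R j) ^ t)) \<in> laurent_over ?W"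
    by (force simp: laurent_over_def in_keys_iff lookup_Z_y split: if_splits)
  then show ?thesis
    using assms by (auto simp: integral_in_def Z_frat_def laurent_over_def)
qed

lemma lam_deg_Z_frat:
  assumes "integral_dens v R" "l \<in> dens R"
  shows "lam_deg v (Z_frat n p R) l = p l * lam_deg v R l"
proof -
  obtain k where "Poly_Mapping.lookup (dexp R l) v = of_int k"
    using assms by (auto simp: integral_dens_def elim: Ints_cases)
  moreover have "of_nat (p l) * of_int k = (of_int (int (p l) * k) :: rat)" by simp
  ultimately show ?thesis
    by (simp add: lam_deg_def Z_frat_def nat_mult_distrib abs_mult del: of_int_mult)
qed

text \<open>The geometric sum uses \<open>pos_exp\<close> because decompositions refer to the
  normalized factors; by \<open>pos_exp_scale\<close>, normalizing commutes with taking the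
  \<open>p l\<close>th power.\<close>

definition cleared_numer ::
  "nat \<Rightarrow> (nat \<Rightarrow> nat) \<Rightarrow> 'k::field frat \<Rightarrow> (nat \<Rightarrow> 'k flaurent fract poly) \<Rightarrow> nat \<Rightarrow>
    'k flaurent fract poly" where
  "cleared_numer v p R A l = A l * (\<Sum>t<p l. xf_poly v (pos_exp v (dexp R l)) ^ t)"

lemma cleared_numer_in_polys:
  assumes "A l \<in> polys (binomial_fractions (free_exps v))"
  shows "cleared_numer v p R A l \<in> polys (binomial_fractions (free_exps v))"
proof -
  note P = subring_polys[OF subring_free_fractions[of v]]
  show ?thesis
    unfolding cleared_numer_def
    by (intro subring_mult[OF P] subring_sum[OF P] subring_power[OF P] assms xf_poly_in_polys)
qed

lemma degree_cleared_numer: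
  assumes R: "integral_dens v R" "l \<in> dens R" and A: "degree (A l) < lam_deg v R l" and p: "0 < p l"
  shows "degree (cleared_numer v p R A l) < p l * lam_deg v R l"
proof -
  let ?X = "xf_poly v (pos_exp v (dexp R l)) :: 'a flaurent fract poly"
  have X: "degree ?X \<le> lam_deg v R l"
    unfolding xf_poly_def using lookup_pos_exp_lam_deg[OF R] by (simp add: degree_monom_le)
  have "degree (?X ^ t) \<le> (p l - 1) * lam_deg v R l" if "t < p l" for t
  proof -
    have "degree (?X ^ t) \<le> degree ?X * t" by (rule degree_power_le)
    also have "\<dots> \<le> lam_deg v R l * (p l - 1)" using X that by (intro mult_le_mono) auto
    finally show ?thesis by (simp add: mult.commute)
  qed
  then have "degree (\<Sum>t<p l. ?X ^ t) \<le> (p l - 1) * lam_deg v R l"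
    by (intro degree_sum_le) auto
  then have "degree (cleared_numer v p R A l) \<le> degree (A l) + (p l - 1) * lam_deg v R l"
    unfolding cleared_numer_def by (meson add_left_mono degree_mult_le le_trans)
  also have "\<dots> < lam_deg v R l + (p l - 1) * lam_deg v R l" using A by simp
  also have "\<dots> = p l * lam_deg v R l" using p by (cases "p l") auto
  finally show ?thesis .
qed

lemma poly_cleared_numer_0:
  assumes R: "integral_dens v R" "l \<in> lam_dens v R" and p: "0 < p l"
  shows "poly (cleared_numer v p R A l) 0 = poly (A l) 0"
proof -
  have "poly (xf_poly v (pos_exp v (dexp R l))) 0 = (0 :: 'a flaurent fract)"
    using lookup_pos_exp_lam_deg[OF R(1), of l] R(2) lam_deg_pos[OF R]
    by (simp add: xf_poly_def poly_monom lam_dens_def)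
  \<comment> \<open>The summand at \<open>t = 0\<close> is \<open>0 ^ 0 = 1\<close>, and
    \<open>0 < p l\<close> ensures that it is present.\<close>
  moreover have "(\<Sum>t<p l. 0 ^ t) = (1 :: 'a flaurent fract)"
    using p by (cases "p l") (simp_all add: sum.lessThan_Suc_shift del: sum.lessThan_Suc)
  ultimately show ?thesis by (simp add: cleared_numer_def poly_sum)
qed

text \<open>Denominators are written as multiplication by \<open>inverse _\<close>, so that
  \<open>Z_fract_mult\<close> can extract them as scalars. Applying \<open>map_poly\<close> cannot
  raise a degree, hence all bounds survive.\<close>

lemma partial_fractions_Z_frat:
  fixes R :: "'k::field frat"
  assumes nv: "n \<le> v" and R: "proper_frat R" "integral_dens v R" and p: "clears n R p"
    and pf: "partial_fractions v R P q t A"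
    and free: "P \<in> polys (binomial_fractions (free_exps v))"
      "q \<in> polys (binomial_fractions (free_exps v))"
      "\<And>l. l \<in> lam_dens v R \<Longrightarrow> A l \<in> polys (binomial_fractions (free_exps v))"
  defines "\<zeta> \<equiv> map_poly (Z_fract n)"
  shows "partial_fractions v (Z_frat n p R) (\<zeta> P) (\<zeta> q) t (\<lambda>l. \<zeta> (cleared_numer v p R A l))"
proof -
  note pf = pf[unfolded partial_fractions_iff[OF R(2)]]
  note Z = subring_Z_domain[where 'a = 'k]
  let ?x = "lam v :: 'k flaurent fract"
  let ?S = "lam_dens v R"
  let ?e = "\<lambda>l. pos_exp v (dexp R l)"
  let ?d = "\<lambda>l. 1 - xf (pos_exp v (dexp (Z_frat n p R) l)) :: 'k flaurent fract"
  have int': "integral_dens v (Z_frat n p R)"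
    using R(2) by (simp add: integral_dens_def Z_frat_def)
  have S: "l \<in> dens R" "0 < p l" if "l \<in> ?S" for l
    using that p by (auto simp: lam_dens_def clears_def)
  have pe: "pos_exp v (dexp (Z_frat n p R) l) = scale (of_nat (p l)) (?e l)" if "l \<in> ?S" for l
    using S[OF that] by (simp add: Z_frat_def pos_exp_scale)
  have pe0: "pos_exp v (dexp (Z_frat n p R) l) \<noteq> 0" if "l \<in> ?S" for l
    using that lam_dens_Z_frat[OF p, of v] by (intro pos_exp_nonzero) simp
  have QC: "cleared_numer v p R A l \<in> polys (binomial_fractions (free_exps v))" if "l \<in> ?S" for l
    by (intro cleared_numer_in_polys free that)
  \<comment> \<open>The factor \<open>1 - x\<close> need not be fixed by \<open>Z_y\<close>, whereas
    \<open>1 - x^p\<close> is; the fraction is extended before the operator is applied.\<close>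
  have summand: "poly (A l) ?x / (1 - xf (?e l)) = poly (cleared_numer v p R A l) ?x * inverse (?d l)"
    if l: "l \<in> ?S" for l
  proof -
    have d: "?d l = (1 - xf (?e l)) * (\<Sum>t<p l. xf (?e l) ^ t)"
      unfolding pe[OF l] xf_scale by (rule one_diff_power_eq)
    have "?d l \<noteq> 0"
      using xf_eq_1_iff[of "pos_exp v (dexp (Z_frat n p R) l)", where 'a = 'k] pe0[OF l] by simp
    then have "1 - xf (?e l) \<noteq> (0 :: 'k flaurent fract)"
        "(\<Sum>t<p l. xf (?e l) ^ t) \<noteq> (0 :: 'k flaurent fract)"
      unfolding d by auto
    then show ?thesis
      unfolding d cleared_numer_def
      by (simp add: poly_sum poly_xf_poly[OF lookup_pos_exp_lam_deg[OF R(2) S(1)[OF l]]]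
          divide_inverse inverse_mult_distrib)
  qed
  have dZ: "inverse (?d l) \<in> Z_domain" "inverse (?d l) \<in> Z_scalars n" if l: "l \<in> ?S" for l
  proof -
    show "inverse (?d l) \<in> Z_domain"
      by (intro inverse_binomial_in_binomial_fractions exp_submonoid_UNIV UNIV_I pe0 l)
    have "Poly_Mapping.lookup (pos_exp v (dexp (Z_frat n p R) l)) w \<in> \<int>" if "w < n" for w
      using p S[OF l] that by (auto simp: pos_exp_def Z_frat_def clears_def)
    then show "inverse (?d l) \<in> Z_scalars n"
      by (intro inverse_Z_scalars subring_diff[OF subring_Z_scalars] subring_one[OF subring_Z_scalars]
          xf_in_Z_scalars)
  qed
  \<comment> \<open>The power of \<lambda> involves no y-variable because \<open>n \<le> v\<close>,
    so it too is a scalar and \<open>t\<close> stays the same.\<close>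
  have xt: "inverse ?x ^ t \<in> Z_domain" "inverse ?x ^ t \<in> Z_scalars n"
    by (intro subring_power[OF Z] subring_power[OF subring_Z_scalars] inverse_Z_scalars
        lam_in_Z_domain lam_in_Z_scalars nv)+
  have PZ: "poly P ?x \<in> Z_domain" and qZ: "poly q ?x * inverse ?x ^ t \<in> Z_domain"
    by (intro subring_mult[OF Z] poly_lam_in_Z_domain free xt)+
  have QZ: "poly (cleared_numer v p R A l) ?x * inverse (?d l) \<in> Z_domain" if "l \<in> ?S" for l
    by (intro subring_mult[OF Z] poly_lam_in_Z_domain[OF QC] dZ that)
  have sumZ: "(\<Sum>l\<in>?S. poly (cleared_numer v p R A l) ?x * inverse (?d l)) \<in> Z_domain"
    by (rule subring_sum[OF Z QZ])
  have Zsum: "Z_fract n (\<Sum>l\<in>?S. poly (cleared_numer v p R A l) ?x * inverse (?d l))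
      = (\<Sum>l\<in>?S. Z_fract n (poly (cleared_numer v p R A l) ?x * inverse (?d l)))"
    by (rule Z_fract_sum[OF QZ])
  have "frat_val (Z_frat n p R) = Z_fract n (frat_val R)"
    using Z_fract_frat_val[OF R(1) p] by simp
  also have "frat_val R = poly P ?x + poly q ?x * inverse ?x ^ t
      + (\<Sum>l\<in>?S. poly (cleared_numer v p R A l) ?x * inverse (?d l))"
    using pf summand by (simp add: divide_inverse power_inverse)
  also have "Z_fract n \<dots> = Z_fract n (poly P ?x) + Z_fract n (poly q ?x * inverse ?x ^ t)
      + (\<Sum>l\<in>?S. Z_fract n (poly (cleared_numer v p R A l) ?x * inverse (?d l)))"
    by (simp only: Z_fract_add[OF subring_add[OF Z PZ qZ] sumZ] Z_fract_add[OF PZ qZ] Zsum)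
  also have "\<dots> = poly (\<zeta> P) ?x + poly (\<zeta> q) ?x * inverse ?x ^ t
      + (\<Sum>l\<in>?S. poly (\<zeta> (cleared_numer v p R A l)) ?x * inverse (?d l))"
  proof -
    have "Z_fract n (poly (cleared_numer v p R A l) ?x * inverse (?d l))
        = poly (\<zeta> (cleared_numer v p R A l)) ?x * inverse (?d l)" if l: "l \<in> ?S" for l
      using Z_fract_mult[OF poly_lam_in_Z_domain[OF QC[OF l]] dZ(2,1)[OF l]]
        Z_fract_poly[OF nv QC[OF l]] by (simp add: \<zeta>_def)
    moreover have "Z_fract n (poly q ?x * inverse ?x ^ t) = poly (\<zeta> q) ?x * inverse ?x ^ t"
      using Z_fract_mult[OF poly_lam_in_Z_domain[OF free(2)] xt(2,1)] Z_fract_poly[OF nv free(2)]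
      by (simp add: \<zeta>_def)
    ultimately show ?thesis using Z_fract_poly[OF nv free(1)] by (simp add: \<zeta>_def)
  qed
  finally have "frat_val (Z_frat n p R) = poly (\<zeta> P) ?x + poly (\<zeta> q) ?x / ?x ^ t
      + (\<Sum>l\<in>lam_dens v (Z_frat n p R). poly (\<zeta> (cleared_numer v p R A l)) ?x / ?d l)"
    by (simp add: divide_inverse power_inverse lam_dens_Z_frat[OF p])
  moreover have "degree (\<zeta> (cleared_numer v p R A l)) < lam_deg v (Z_frat n p R) l" if l: "l \<in> ?S" for l
    using degree_cleared_numer[where p = p and A = A, OF R(2) S(1)[OF l] _ S(2)[OF l]] pf l
      map_poly_degree_leq[of "Z_fract n" "cleared_numer v p R A l"]
    unfolding lam_deg_Z_frat[OF R(2) S(1)[OF l]] \<zeta>_def by (meson le_less_trans)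
  moreover have "degree (\<zeta> q) < t"
    using pf map_poly_degree_leq[of "Z_fract n" q] unfolding \<zeta>_def by (meson le_less_trans)
  ultimately show ?thesis
    unfolding partial_fractions_iff[OF int'] lam_dens_Z_frat[OF p]
    using free QC by (auto simp: \<zeta>_def map_poly_Z_in_polys)
qed

section \<open>Integral \<lambda>-exponents and the commutation of the two operators\<close>

lemma common_denominator:
  assumes "finite Q"
  shows "\<exists>m>0. \<forall>q\<in>Q. of_nat m * (q :: rat) \<in> \<int>"
  using assms
proof (induction Q rule: finite_induct)
  case empty
  then show ?case by auto
next
  case (insert q Q)
  then obtain m where m: "0 < m" "\<forall>q\<in>Q. of_nat m * (q :: rat) \<in> \<int>" by blast
  obtain a b where ab: "q = of_int a / of_int b" "0 < b"
    by (metis quotient_of_denom_pos' quotient_of_div surj_pair prod.collapse)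
  have "of_nat (nat b) * q = of_int a" using ab by simp
  then have 1: "of_nat (m * nat b) * q \<in> \<int>"
    by (simp add: mult.assoc)
  have 2: "of_nat (m * nat b) * x \<in> \<int>" if "x \<in> Q" for x
  proof -
    have "of_nat (nat b) * (of_nat m * x) \<in> \<int>"
      using m(2) that by (blast intro: Ints_mult Ints_of_nat)
    then show ?thesis by (simp only: of_nat_mult mult_ac)
  qed
  show ?case using 1 2 m(1) ab(2) by (intro exI[of _ "m * nat b"]) auto
qed

lemma stretch_integral:
  assumes "finite (dens R)"
  shows "\<exists>m>0. integral_in v (stretch v m R)"
proof -
  let ?E = "Poly_Mapping.keys (numer R) \<union> dexp R ` dens R"
  obtain m where m: "0 < m" "\<forall>q\<in>(\<lambda>e. Poly_Mapping.lookup e v) ` ?E. of_nat m * q \<in> \<int>"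
    using common_denominator[of "(\<lambda>e. Poly_Mapping.lookup e v) ` ?E"] assms by auto
  have "Poly_Mapping.keys (stretch_laurent v m (numer R)) \<subseteq> stretch_exp v m ` Poly_Mapping.keys (numer R)"
    unfolding stretch_laurent_def by (rule order_trans[OF keys_sum]) auto
  then show ?thesis
    using m by (intro exI[of _ m]) (auto simp: integral_in_def stretch_def lookup_stretch_exp)
qed

text \<open>One \<open>m\<close> serves both sides: it is chosen for \<open>R\<close>, stretching
  commutes with \<open>Z_frat\<close>, and \<open>Z_frat\<close> preserves integrality of
  \<lambda>-exponents. The decomposition of the stretched \<open>R\<close> and its image then
  compute the two values.\<close>

lemma CT_Z_frat:
  fixes R :: "'k::field frat"
  assumes nv: "n \<le> v" and R: "proper_frat R" "coprime_dens R" and p: "clears n R p"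
    and j: "j \<in> lam_dens v R"
  shows "CT v j (Z_frat n p R) = Z_fract n (CT v j R)"
proof -
  obtain m where m: "0 < m" "integral_in v (stretch v m R)"
    using stretch_integral[of R v] R(1) by (auto simp: proper_frat_def)
  let ?T = "stretch v m R"
  have T: "proper_frat ?T" "coprime_dens ?T" "j \<in> lam_dens v ?T"
    using R j m(1) by (simp_all add: proper_frat_stretch coprime_dens_stretch lam_dens_stretch)
  note int = integral_in_imp_integral_dens[OF m(2)]
  have pT: "clears n ?T p"
    using p nv by (auto simp: clears_def stretch_def lookup_stretch_exp)
  obtain P q t A where pf: "partial_fractions v ?T P q t A"
    and free: "P \<in> polys (binomial_fractions (free_exps v))"
      "q \<in> polys (binomial_fractions (free_exps v))"
      "\<And>l. l \<in> lam_dens v ?T \<Longrightarrow> A l \<in> polys (binomial_fractions (free_exps v))"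
    using partial_fractions_exist[OF T(1,2) m(2)] by blast
  let ?Q = "\<lambda>l. map_poly (Z_fract n) (cleared_numer v p ?T A l)"
  have "partial_fractions v (stretch v m (Z_frat n p R))
      (map_poly (Z_fract n) P) (map_poly (Z_fract n) q) t ?Q"
    unfolding stretch_Z_frat[OF nv]
    by (intro partial_fractions_Z_frat nv T(1) int pT pf free)
  then have "CT v j (Z_frat n p R) = poly (?Q j) 0"
    using j m integral_in_Z_frat[OF m(2)]
    by (intro CT_eq proper_frat_Z_frat coprime_dens_Z_frat p R)
      (auto simp: lam_dens_Z_frat[OF p] stretch_Z_frat[OF nv])
  also have "\<dots> = Z_fract n (poly (cleared_numer v p ?T A j) 0)"
    by (simp add: poly_0_coeff_0 coeff_map_poly)
  also have "poly (cleared_numer v p ?T A j) 0 = poly (A j) 0"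
    using pT T(3) by (intro poly_cleared_numer_0 int T(3)) (auto simp: clears_def lam_dens_def)
  also have "poly (A j) 0 = CT v j R"
    using CT_eq[OF R j m pf] by simp
  finally show ?thesis .
qed


section \<open>Matrix forms\<close>

text \<open>A pivot adds multiples of column \<open>j\<close> to the others. In a row
  \<open>l < n\<close> with \<open>l\<close> outside the new \<open>J\<close>, column
  \<open>j\<close> has entry 0, so the unit row persists, including its zero in the last
  column.\<close>

lemma matrix_form_row:
  assumes "A \<in> carrier_mat r n" "matrix_form n r (start_mat n r A b) k I J N"
  shows "dim_row N = n + r \<and> dim_col N = Suc n \<and>
    (\<forall>l<n. l \<notin> J \<longrightarrow> (\<forall>s\<le>n. N $$ (l, s) = (if s = l then 1 else 0)))"
  using assms(2)
proof (induction rule: matrix_form.induct)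
  case init
  then show ?case using assms(1) by (auto simp: start_mat_def)
next
  case (step k I J N i j)
  then show ?case by (auto simp: pivot_def)
qed

lemma lookup_col_exp:
  assumes "l < n" "n \<le> dim_row N"
  shows "Poly_Mapping.lookup (col_exp n I N s) l = N $$ (l, s)"
proof -
  have "Poly_Mapping.lookup (col_exp n I N s) l
      = (\<Sum>w \<in> {..<dim_row N} - (+) n ` I. N $$ (w, s) when w = l)"
    by (simp add: col_exp_def lookup_sum lookup_single)
  also have "\<dots> = N $$ (l, s)"
    using assms by (auto simp: when_def)
  finally show ?thesis .
qed

lemma lookup_col_exp_lam:
  assumes "i \<notin> I" "n + i < dim_row N"
  shows "Poly_Mapping.lookup (col_exp n I N s) (n + i) = N $$ (n + i, s)"
  using assms by (auto simp: col_exp_def lookup_sum lookup_single when_def)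

theorem proposition11:
  fixes n r k i j :: nat
    and A :: "int mat" and b :: "int vec"
    and I J :: "nat set" and N :: "rat mat"
    and p :: "nat \<Rightarrow> nat"
    and F :: "'k::field_char_0 frat"
  assumes "A \<in> carrier_mat r n" and "b \<in> carrier_vec r"
    and "matrix_form n r (start_mat n r A b) k I J N"
    and "i \<in> {..<r} - I" and "j \<in> {..<n} - J"
    and "N $$ (n + i, j) \<noteq> 0"
    and "F = mat_frat n I J N"
    and "clears n F p"
  shows "CT (n + i) j (Z_frat n p F) = Z_fract n (CT (n + i) j F)"
proof (rule CT_Z_frat[OF _ _ _ assms(8)])
  note N = matrix_form_row[OF assms(1,3)]
  \<comment> \<open>Among the remaining denominator factors, each y-variable with index in
    \<open>dens F\<close> occurs only in its own factor, with exponent 1. This gives both properness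
    and non-proportionality.\<close>
  have col: "Poly_Mapping.lookup (dexp F s) l = (if s = l then 1 else 0)"
    if "s \<in> dens F" "l \<in> dens F" for s l
    using that N by (auto simp: assms(7) mat_frat_def lookup_col_exp)
  show "proper_frat F"
    unfolding proper_frat_def
  proof
    show "\<forall>s\<in>dens F. dexp F s \<noteq> 0"
      using col by (metis lookup_zero zero_neq_one)
  qed (simp add: assms(7) mat_frat_def)
  show "coprime_dens F"
    unfolding coprime_dens_def
  proof (intro ballI impI allI notI)
    fix l l' and c d :: rat
    assume l: "l \<in> dens F" "l' \<in> dens F" "l \<noteq> l'" and c: "c \<noteq> 0"
      and eq: "scale c (dexp F l) = scale d (dexp F l')"
    \<comment> \<open>Coordinate \<open>l\<close> reads \<open>c * 1 = d * 0\<close>, contradicting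
      \<open>c \<noteq> 0\<close>.\<close>
    have "c * Poly_Mapping.lookup (dexp F l) l = d * Poly_Mapping.lookup (dexp F l') l"
      using arg_cong[OF eq, of "\<lambda>e. Poly_Mapping.lookup e l"] by simp
    then show False using l c by (simp add: col)
  qed
  \<comment> \<open>Row \<open>n + i\<close> is not ignored since \<open>i\<close> lies outside
    \<open>I\<close>, so the \<lambda>-exponent of the \<open>j\<close>th factor is the nonzero
    matrix entry.\<close>
  show "j \<in> lam_dens (n + i) F"
    using assms(4-6) N by (simp add: assms(7) lam_dens_def mat_frat_def lookup_col_exp_lam)
qed simp

end
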